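(* Let $\mathsf H$ be a separable Hilbert space and let $(\mu_n)_{n\in\mathbb N}$ be a sequence in $\mathcal P_2(\mathsf H)$ converging to $\mu\in\mathcal P_2(\mathsf H)$ in $\mathcal P_2^w(\mathsf H)$. Then $$W_2^2(\nu,\mu)+\liminf_{n\to\infty}W_2^2(\mu_n,\mu)\le\liminf_{n\to\infty}W_2^2(\mu_n,\nu)\qquad\text{for every }\nu\in\mathcal P_2(\mathsf H).$$ In particular, $$\liminf_{n\to\infty}W_2(\mu_n,\mu)<\liminf_{n\to\infty}W_2(\mu_n,\nu)\qquad\text{for every }\nu\in\mathcal P_2(\mathsf H)\text{ with }\nu\ne\mu.$$
   Context: $(\mathsf H,|\cdot|)$ is a separable Hilbert space. $\mathcal P_2(\mathsf H)$ is the set of Borel probability measures $\mu$ on $\mathsf H$ with $\int|x|^2\,\mathrm d\mu<\infty$, and $W_2$ is the $L^2$-Kantorovich-Rubinstein-Wasserstein distance: $W_2^2(\mu_0,\mu_1)$ is the minimum of $\int|x_1-x_2|^2\,\mathrm d\boldsymbol\mu$ over all Borel probability measures $\boldsymbol\mu$ on $\mathsf H\times\mathsf H$ with marginals $\mu_0,\mu_1$. $\mathcal P_2^w(\mathsf H)$ is the set $\mathcal P_2(\mathsf H)$ endowed with the coarsest topology making all maps $\mu\mapsto\int\zeta\,\mathrm d\mu$ continuous, where $\zeta:\mathsf H\to\mathbb R$ ranges over the sequentially weakly continuous functions with $\lim_{|x|\to\infty}\zeta(x)/(1+|x|^2)=0$. *)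

theory Defs
  imports "HOL-Probability.Probability"
begin

text \<open>
  A separable (real) Hilbert space is a type of sort
  \<open>{real_inner, complete_space, second_countable_topology}\<close>; for metric spaces,
  second countability and separability coincide.
\<close>

definition P2 :: "'a::{real_inner, complete_space, second_countable_topology} measure set" where
  "P2 = {\<mu>. prob_space \<mu> \<and> sets \<mu> = sets borel \<and> integrable \<mu> (\<lambda>x. (norm x)\<^sup>2)}"

definition couplings ::
  "'a::{real_inner, complete_space, second_countable_topology} measure \<Rightarrow> 'a measure
    \<Rightarrow> ('a \<times> 'a) measure set" where
  "couplings \<mu>\<^sub>0 \<mu>\<^sub>1 = {\<gamma>. prob_space \<gamma> \<and> sets \<gamma> = sets borel \<and>
     distr \<gamma> borel fst = \<mu>\<^sub>0 \<and> distr \<gamma> borel snd = \<mu>\<^sub>1}"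

text \<open>
  The minimum over all couplings is written as an infimum, so that its attainment is not
  built into the definition. On \<open>P2\<close> the infimum is finite (the product measure is a coupling of
  finite cost), so \<open>enn2real\<close> loses nothing there.
\<close>

definition W2 ::
  "'a::{real_inner, complete_space, second_countable_topology} measure \<Rightarrow> 'a measure \<Rightarrow> real" where
  "W2 \<mu>\<^sub>0 \<mu>\<^sub>1 = sqrt (enn2real
     (INF \<gamma>\<in>couplings \<mu>\<^sub>0 \<mu>\<^sub>1. \<integral>\<^sup>+ z. ennreal ((norm (fst z - snd z))\<^sup>2) \<partial>\<gamma>))"

definition weakly_converges :: "(nat \<Rightarrow> 'a::real_inner) \<Rightarrow> 'a \<Rightarrow> bool" where
  "weakly_converges xs x \<longleftrightarrow> (\<forall>y. (\<lambda>n. xs n \<bullet> y) \<longlonglongrightarrow> x \<bullet> y)"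

definition seq_weakly_continuous :: "('a::real_inner \<Rightarrow> real) \<Rightarrow> bool" where
  "seq_weakly_continuous \<zeta> \<longleftrightarrow>
     (\<forall>xs x. weakly_converges xs x \<longrightarrow> (\<lambda>n. \<zeta> (xs n)) \<longlonglongrightarrow> \<zeta> x)"

definition test_functions :: "('a::real_inner \<Rightarrow> real) set" where
  "test_functions = {\<zeta>. seq_weakly_continuous \<zeta> \<and>
     ((\<lambda>x. \<zeta> x / (1 + (norm x)\<^sup>2)) \<longlongrightarrow> 0) at_infinity}"

definition P2w ::
  "'a::{real_inner, complete_space, second_countable_topology} measure topology" where
  "P2w = topology_generated_by
     {{\<mu> \<in> P2. (\<integral>x. \<zeta> x \<partial>\<mu>) \<in> U} | \<zeta> U. \<zeta> \<in> test_functions \<and> open U}"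

lemma topspace_P2w: "topspace P2w = P2"
proof -
  have "(\<lambda>_. 0) \<in> test_functions"
    by (simp add: test_functions_def seq_weakly_continuous_def)
  then show ?thesis
    unfolding P2w_def topology_generated_by_topspace by blast
qed

lemma continuous_map_P2w_integral:
  assumes "\<zeta> \<in> test_functions"
  shows "continuous_map P2w euclideanreal (\<lambda>\<mu>. \<integral>x. \<zeta> x \<partial>\<mu>)"
  unfolding continuous_map_def topspace_P2w
  using assms by (auto simp: P2w_def intro!: topology_generated_by_Basis)

lemma P2w_coarsest:
  assumes "topspace T = P2"
    and "\<And>\<zeta>. \<zeta> \<in> test_functions \<Longrightarrow> continuous_map T euclideanreal (\<lambda>\<mu>. \<integral>x. \<zeta> x \<partial>\<mu>)"
    and "openin P2w V"
  shows "openin T V"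
proof -
  have "openin T B" if "B \<in> {{\<mu> \<in> P2. (\<integral>x. \<zeta> x \<partial>\<mu>) \<in> U} | \<zeta> U. \<zeta> \<in> test_functions \<and> open U}" for B
    using that assms(1,2) by (force simp: continuous_map_def)
  then show ?thesis
    using assms(3) unfolding P2w_def openin_topology_generated_by_iff
    by (metis (no_types, lifting) generate_topology_on_coarsest istopology_openin)
qed

end

theory Submission
  imports Defs
begin

text \<open>
  For a plan \<open>\<Theta>\<close> on triples \<open>(x, y, x')\<close> whose marginals on \<open>(x, y)\<close> and \<open>x'\<close> are a nearly optimal
  coupling of \<open>\<mu>\<^sub>n, \<nu>\<close> and \<open>\<mu>\<close>, the identity
  \<open>|x - x'|\<^sup>2 + |x' - y|\<^sup>2 = |x - y|\<^sup>2 + 2 \<langle>x' - x, x' - y\<rangle>\<close> gives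
  \<open>W\<^sub>2\<^sup>2(\<mu>\<^sub>n, \<mu>) + W\<^sub>2\<^sup>2(\<nu>, \<mu>) \<le> W\<^sub>2\<^sup>2(\<mu>\<^sub>n, \<nu>) + o(1)\<close>, provided that \<open>x' - x\<close> becomes small in
  finitely many directions and \<open>\<integral>|x|\<^sup>2 d\<mu>\<^sub>n\<close> stays bounded: up to a small error in \<open>L\<^sup>2\<close>, the fixed
  laws \<open>\<mu>\<close> and \<open>\<nu>\<close> of \<open>x'\<close> and \<open>y\<close> live on a finite set.
  Neither optimal plans nor disintegration is needed: \<open>\<Theta>\<close> has an explicit density with respect to the
  product of the coupling of \<open>\<mu>\<^sub>n, \<nu>\<close> with \<open>\<mu>\<close>, built from a finite weakly continuous partition of
  unity \<open>\<phi>\<^sub>k\<close>; it matches the part of \<open>\<mu>\<^sub>n\<close> lying in block \<open>k\<close> with the part of \<open>\<mu>\<close> in the same block,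
  except for a mass that vanishes because \<open>\<integral>\<phi>\<^sub>k d\<mu>\<^sub>n \<rightarrow> \<integral>\<phi>\<^sub>k d\<mu>\<close>.
  For the strict inequality one also needs that the second moments of \<open>\<mu>\<^sub>n\<close> do not tend to infinity,
  which is a gliding hump argument: otherwise a series of bounded test functions would be a test
  function with unbounded integrals.
\<close>

section \<open>Weakly continuous functions\<close>

lemma weakly_convergesI_tendsto:
  assumes "xs \<longlonglongrightarrow> x"
  shows "weakly_converges xs x"
  unfolding weakly_converges_def using assms by (auto intro!: tendsto_intros)

lemma continuous_on_seq_weakly_continuous:
  fixes f :: "'a::real_inner \<Rightarrow> real"
  assumes "seq_weakly_continuous f"
  shows "continuous_on UNIV f"
  unfolding continuous_on_sequentially comp_def
  using assms weakly_convergesI_tendsto by (auto simp: seq_weakly_continuous_def)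

lemma borel_measurable_seq_weakly_continuous:
  fixes f :: "'a::real_inner \<Rightarrow> real"
  assumes "seq_weakly_continuous f"
  shows "f \<in> borel_measurable borel"
  using assms by (intro borel_measurable_continuous_onI continuous_on_seq_weakly_continuous)

lemma seq_weakly_continuous_inner:
  assumes "continuous_on UNIV g"
  shows "seq_weakly_continuous (\<lambda>x. g (x \<bullet> d))"
  unfolding seq_weakly_continuous_def weakly_converges_def
  using continuous_on_tendsto_compose[OF assms] by auto

text \<open>The uniform boundedness principle, by Baire category: the closed sets \<open>C k\<close>
  cover the space, so one of them contains a ball \<open>cball y r\<close>. Each \<open>xs n\<close>
  is then tested against a vector of length \<open>r\<close> in its own direction, which yields the
  bound \<open>2 * k / r\<close>.\<close>

lemma weakly_converges_bounded:
  fixes xs :: "nat \<Rightarrow> 'a::{real_inner, complete_space}"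
  assumes "weakly_converges xs x"
  obtains M where "\<And>n. norm (xs n) \<le> M"
proof -
  define C where "C k = {y. \<forall>n. \<bar>xs n \<bullet> y\<bar> \<le> real k}" for k :: nat
  have cl: "closed (C k)" for k
    unfolding C_def by (intro closed_Collect_all closed_Collect_le continuous_intros)
  have un: "(\<Union>k. C k) = UNIV"
  proof -
    have "\<exists>k. y \<in> C k" for y
    proof -
      have "Bseq (\<lambda>n. xs n \<bullet> y)"
        using assms unfolding weakly_converges_def by (blast intro: convergent_imp_Bseq convergentI)
      then obtain K where "\<And>n. \<bar>xs n \<bullet> y\<bar> \<le> K"
        by (auto simp: Bseq_def)
      moreover obtain k :: nat where "K \<le> real k"
        using real_arch_simple by blast
      ultimately show ?thesis
        unfolding C_def by (auto intro: order_trans)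
    qed
    then show ?thesis by auto
  qed
  have "\<exists>k. interior (C k) \<noteq> {}"
  proof (rule ccontr)
    assume *: "\<not> ?thesis"
    have "euclidean interior_of \<Union>(range C) = {}"
    proof (rule Baire_category_alt)
      show "completely_metrizable_space (euclidean :: 'a topology) \<or>
        locally_compact_space (euclidean :: 'a topology) \<and> regular_space (euclidean :: 'a topology)"
        by (simp add: completely_metrizable_space_euclidean)
    qed (use * cl in auto)
    then show False using un by simp
  qed
  then obtain k y where "y \<in> interior (C k)" by auto
  then obtain r where r: "r > 0" "cball y r \<subseteq> C k"
    by (auto simp: mem_interior_cball)
  have "norm (xs n) \<le> 2 * k / r" for n
  proof (cases "xs n = 0")
    case False
    define z where "z = (r / norm (xs n)) *\<^sub>R xs n"
    have "norm z = r" using False r by (simp add: z_def)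
    then have "y + z \<in> C k" "y \<in> C k" using r by (auto simp: dist_norm)
    then have "\<bar>xs n \<bullet> (y + z)\<bar> \<le> k" "\<bar>xs n \<bullet> y\<bar> \<le> k"
      by (auto simp: C_def)
    then have "xs n \<bullet> z \<le> 2 * k" by (simp add: inner_add_right)
    moreover have "xs n \<bullet> z = r * norm (xs n)"
      using False by (simp add: z_def power2_norm_eq_inner[symmetric] power2_eq_square)
    ultimately show ?thesis using r by (simp add: field_simps)
  qed (use r in auto)
  then show ?thesis using that by blast
qed

lemma seq_weakly_continuous_min:
  assumes "seq_weakly_continuous f" "seq_weakly_continuous g"
  shows "seq_weakly_continuous (\<lambda>x. min (f x) (g x))"
  using assms unfolding seq_weakly_continuous_def by (auto intro!: tendsto_min)

lemma seq_weakly_continuous_max: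
  assumes "seq_weakly_continuous f" "seq_weakly_continuous g"
  shows "seq_weakly_continuous (\<lambda>x. max (f x) (g x))"
  using assms unfolding seq_weakly_continuous_def by (auto intro!: tendsto_max)

lemma seq_weakly_continuous_prod:
  assumes "\<And>i. i \<in> I \<Longrightarrow> seq_weakly_continuous (f i)"
  shows "seq_weakly_continuous (\<lambda>x. \<Prod>i\<in>I. f i x :: real)"
  using assms unfolding seq_weakly_continuous_def by (auto intro!: tendsto_prod)

section \<open>Growth at infinity and membership in \<open>test_functions\<close>\<close>

lemma filterlim_one_plus_norm_square:
  "filterlim (\<lambda>x::'a::real_normed_vector. 1 + (norm x)\<^sup>2) at_top at_infinity"
proof -
  have "filterlim (\<lambda>t::real. 1 + t\<^sup>2) at_top at_top"
    by (intro filterlim_tendsto_add_at_top[OF tendsto_const] filterlim_pow_at_top filterlim_ident) simp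
  then show ?thesis
    by (rule filterlim_compose[OF _ filterlim_norm_at_top])
qed

lemma test_functions_bounded:
  assumes "seq_weakly_continuous f" "\<And>x. \<bar>f x\<bar> \<le> B"
  shows "f \<in> test_functions"
proof -
  have "((\<lambda>x. f x / (1 + (norm x)\<^sup>2)) \<longlongrightarrow> 0) at_infinity"
  proof (rule Lim_null_comparison)
    show "((\<lambda>x. B / (1 + (norm x)\<^sup>2)) \<longlongrightarrow> 0) at_infinity"
      by (intro real_tendsto_divide_at_top[OF tendsto_const] filterlim_one_plus_norm_square)
    show "\<forall>\<^sub>F x in at_infinity. norm (f x / (1 + (norm x)\<^sup>2)) \<le> B / (1 + (norm x)\<^sup>2)"
      using assms(2) by (intro always_eventually allI) (auto simp: divide_right_mono)
  qed
  then show ?thesis using assms by (simp add: test_functions_def)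
qed

text \<open>Tannery's theorem is used twice. Along a weakly convergent sequence the norms stay below
  some \<open>M\<close>, so the terms are dominated by \<open>a k * M\<^sup>2\<close>; at infinity
  the quotients are dominated by \<open>a k\<close>, and each tends to 0 because \<open>f k\<close>
  is bounded. The bounds \<open>B k\<close> may grow arbitrarily with \<open>k\<close>, on which the
  gliding hump relies.\<close>

lemma test_functions_suminf:
  fixes f :: "nat \<Rightarrow> 'a::{real_inner, complete_space} \<Rightarrow> real"
  assumes swc: "\<And>k. seq_weakly_continuous (f k)"
    and bdd: "\<And>k x. \<bar>f k x\<bar> \<le> B k"
    and growth: "\<And>k x. \<bar>f k x\<bar> \<le> (norm x)\<^sup>2"
    and a: "summable a" "\<And>k. a k \<ge> 0"
  shows "(\<lambda>x. \<Sum>k. a k * f k x) \<in> test_functions"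
proof -
  have "seq_weakly_continuous (\<lambda>x. \<Sum>k. a k * f k x)"
    unfolding seq_weakly_continuous_def
  proof (intro allI impI)
    fix xs and x :: 'a assume w: "weakly_converges xs x"
    then obtain M where M: "\<And>n. norm (xs n) \<le> M" using weakly_converges_bounded by blast
    show "(\<lambda>n. \<Sum>k. a k * f k (xs n)) \<longlonglongrightarrow> (\<Sum>k. a k * f k x)"
    proof (rule tannerys_theorem[THEN conjunct2, THEN conjunct2])
      show "(\<lambda>n. a k * f k (xs n)) \<longlonglongrightarrow> a k * f k x" for k
        using swc w by (auto simp: seq_weakly_continuous_def intro!: tendsto_intros)
      show "summable (\<lambda>k. a k * M\<^sup>2)" using a by (intro summable_mult2)
      have "norm (a k * f k (xs n)) \<le> a k * M\<^sup>2" for k n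
        using growth[of k "xs n"] a(2)[of k] power_mono[OF M[of n] norm_ge_zero, of 2]
        by (auto simp: abs_mult intro!: mult_left_mono)
      then show "\<forall>\<^sub>F (k, n) in at_top \<times>\<^sub>F sequentially. norm (a k * f k (xs n)) \<le> a k * M\<^sup>2"
        by (intro always_eventually) auto
    qed simp
  qed
  moreover have "((\<lambda>x. (\<Sum>k. a k * f k x) / (1 + (norm x)\<^sup>2)) \<longlongrightarrow> 0) at_infinity"
  \<comment> \<open>The filter is trivial exactly on the zero space, where every limit holds;
    Tannery's theorem asks for a nontrivial filter.\<close>
  proof (cases "(at_infinity :: 'a filter) = bot")
    case False
    have le: "norm (a k * f k x / (1 + (norm x)\<^sup>2)) \<le> a k" for k x
    proof -
      have "\<bar>f k x\<bar> / (1 + (norm x)\<^sup>2) \<le> 1"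
        using growth[of k x] by (subst pos_divide_le_eq) (auto simp: add_pos_nonneg)
      from mult_left_mono[OF this a(2)[of k]] show ?thesis by (simp add: abs_mult a(2))
    qed
    have "((\<lambda>x. \<Sum>k. a k * f k x / (1 + (norm x)\<^sup>2)) \<longlongrightarrow> (\<Sum>k. 0)) at_infinity"
    proof (rule tannerys_theorem[THEN conjunct2, THEN conjunct2])
      show "((\<lambda>x. a k * f k x / (1 + (norm x)\<^sup>2)) \<longlongrightarrow> 0) at_infinity" for k
      proof -
        have "((\<lambda>x. f k x / (1 + (norm x)\<^sup>2)) \<longlongrightarrow> 0) at_infinity"
          using test_functions_bounded[OF swc bdd] by (simp add: test_functions_def)
        from tendsto_mult_right_zero[OF this, of "a k"] show ?thesis by simp
      qed
      show "\<forall>\<^sub>F (k, x) in at_top \<times>\<^sub>F at_infinity. norm (a k * f k x / (1 + (norm x)\<^sup>2)) \<le> a k"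
        using le by (intro always_eventually) auto
    qed (use a False in auto)
    moreover have "(\<Sum>k. a k * f k x / (1 + (norm x)\<^sup>2)) = (\<Sum>k. a k * f k x) / (1 + (norm x)\<^sup>2)" for x
    proof (rule suminf_divide)
      show "summable (\<lambda>k. a k * f k x)"
        by (rule summable_comparison_test'[where g="\<lambda>k. a k * (norm x)\<^sup>2" and N=0])
          (use a growth[of _ x] in \<open>auto simp: abs_mult intro!: summable_mult2 mult_left_mono\<close>)
    qed
    ultimately show ?thesis by simp
  qed simp
  ultimately show ?thesis by (simp add: test_functions_def)
qed

lemma limitin_P2w_imp_tendsto:
  assumes "limitin P2w \<mu>s \<mu> sequentially" "\<zeta> \<in> test_functions"
  shows "(\<lambda>n. \<integral>x. \<zeta> x \<partial>\<mu>s n) \<longlonglongrightarrow> (\<integral>x. \<zeta> x \<partial>\<mu>)"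
  using continuous_map_limit[OF continuous_map_P2w_integral[OF assms(2)] assms(1)]
  by (simp add: comp_def)

section \<open>Weakly continuous partitions of unity\<close>

definition clamp1 :: "real \<Rightarrow> real" where
  "clamp1 t = max 0 (min 1 t)"

text \<open>
  The hat function \<open>max 0 (1 - |s - k|)\<close> at the rescaled, truncated point \<open>s \<in> [0, 2 j\<^sup>2]\<close>, written as a
  difference of ramps so that the sum over \<open>k\<close> telescopes.
\<close>

definition tent :: "nat \<Rightarrow> nat \<Rightarrow> real \<Rightarrow> real" where
  "tent j k t = (let s = real j * max (- real j) (min (real j) t) + real (j\<^sup>2)
     in clamp1 (s + 1 - real k) - clamp1 (s - real k))"

lemma tent_nonneg: "0 \<le> tent j k t"
  by (auto simp: tent_def Let_def clamp1_def)

lemma continuous_on_tent: "continuous_on UNIV (tent j k)"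
  unfolding tent_def Let_def clamp1_def by (intro continuous_intros)

lemma sum_tent: "(\<Sum>k\<le>2 * j\<^sup>2. tent j k t) = 1"
proof -
  define s where "s = real j * max (- real j) (min (real j) t) + real (j\<^sup>2)"
  define u where "u = max (- real j) (min (real j) t)"
  have "- real j \<le> u" "u \<le> real j" by (auto simp: u_def)
  then have "real j * u \<le> real j * real j" "real j * (- real j) \<le> real j * u"
    by (intro mult_left_mono; simp)+
  then have s: "0 \<le> s" "s \<le> 2 * real (j\<^sup>2)"
    by (auto simp: s_def u_def[symmetric] power2_eq_square)
  have "(\<Sum>k\<le>2 * j\<^sup>2. tent j k t) = (\<Sum>k\<le>2 * j\<^sup>2. clamp1 (s + 1 - real k) - clamp1 (s + 1 - real (Suc k)))"
    unfolding tent_def Let_def s_def[symmetric] by simp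
  also have "\<dots> = clamp1 (s + 1 - real 0) - clamp1 (s + 1 - real (Suc (2 * j\<^sup>2)))"
    by (rule sum_telescope)
  \<comment> \<open>The first ramp is saturated because \<open>0 \<le> s\<close>, and the last one
    has not started because \<open>s \<le> 2 * real (j\<^sup>2)\<close>.\<close>
  also have "\<dots> = 1" using s by (simp add: clamp1_def)
  finally show ?thesis .
qed

text \<open>Truncation acts only where \<open>R < \<bar>t\<bar>\<close>; there the error is at most
  \<open>\<bar>t\<bar>\<close>, and \<open>R * \<bar>t\<bar> \<le> t\<^sup>2\<close>. The error is
  thereby charged to a second moment.\<close>

lemma abs_diff_clamp_le:
  assumes "0 < (R::real)"
  shows "\<bar>t - max (- R) (min R t)\<bar> \<le> t\<^sup>2 / R"
proof (cases "\<bar>t\<bar> \<le> R")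
  case False
  then have "R * \<bar>t\<bar> \<le> \<bar>t\<bar> * \<bar>t\<bar>" by (intro mult_right_mono) auto
  then have "\<bar>t\<bar> \<le> t\<^sup>2 / R"
    using assms by (simp add: field_simps power2_eq_square)
  then show ?thesis using assms False by (auto simp: abs_real_def max_def min_def split: if_splits)
qed (use assms in auto)

lemma clamp1_diff_nonzero: "clamp1 (s + 1 - r) - clamp1 (s - r) \<noteq> 0 \<Longrightarrow> \<bar>s - r\<bar> < 1"
  by (auto simp: clamp1_def max_def min_def split: if_splits)

text \<open>Two points under one hat have rescaled truncated values at distance at most 2, so the
  truncated values differ by at most \<open>2 / j\<close>; the remainder is truncation error. Since
  \<open>j\<close> is both the truncation level and the inverse mesh width, a large \<open>j\<close>
  makes both contributions small once second moments are bounded.\<close>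

lemma tent_common_support:
  assumes "0 < j" "tent j k t \<noteq> 0" "tent j k t' \<noteq> 0"
  shows "\<bar>t - t'\<bar> \<le> 2 / j + (t\<^sup>2 + t'\<^sup>2) / j"
proof -
  define c where "c t = max (- real j) (min (real j) t)" for t
  have "\<bar>real j * c t + real (j\<^sup>2) - real k\<bar> < 1" "\<bar>real j * c t' + real (j\<^sup>2) - real k\<bar> < 1"
    using assms(2,3) clamp1_diff_nonzero unfolding tent_def Let_def c_def[symmetric] by blast+
  then have "\<bar>real j * c t - real j * c t'\<bar> \<le> 2" by linarith
  then have "real j * \<bar>c t - c t'\<bar> \<le> 2"
    by (simp add: right_diff_distrib[symmetric] abs_mult)
  then have "\<bar>c t - c t'\<bar> \<le> 2 / j"
    using assms by (simp add: field_simps)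
  moreover have "\<bar>t - c t\<bar> \<le> t\<^sup>2 / j" "\<bar>t' - c t'\<bar> \<le> t'\<^sup>2 / j"
    using abs_diff_clamp_le[of "real j"] assms by (auto simp: c_def)
  ultimately show ?thesis unfolding add_divide_distrib by linarith
qed

definition weak_partition :: "'b set \<Rightarrow> ('b \<Rightarrow> 'a::real_inner \<Rightarrow> real) \<Rightarrow> bool" where
  "weak_partition I \<phi> \<longleftrightarrow> finite I \<and> (\<forall>k\<in>I. seq_weakly_continuous (\<phi> k)) \<and>
     (\<forall>k\<in>I. \<forall>x. 0 \<le> \<phi> k x) \<and> (\<forall>x. (\<Sum>k\<in>I. \<phi> k x) = 1)"

lemma weak_partition_le_1:
  assumes "weak_partition I \<phi>" "k \<in> I"
  shows "\<phi> k x \<le> 1"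
  using member_le_sum[of k I "\<lambda>k. \<phi> k x"] assms by (auto simp: weak_partition_def)

text \<open>An index selects one hat for each direction in \<open>D\<close>, and the partition
  function is the product of the selected hats. Expanding the product of the one-dimensional sums,
  all equal to 1, gives total 1. A nonzero product has no zero factor, so the one-dimensional
  estimate holds in all directions at once.\<close>

lemma fine_weak_partition:
  fixes D :: "'a::real_inner set"
  assumes "finite D" "0 < j"
  obtains I and \<phi> :: "('a \<Rightarrow> nat) \<Rightarrow> 'a \<Rightarrow> real"
  where "weak_partition I \<phi>"
    and "\<And>k x x' d. \<lbrakk>k \<in> I; \<phi> k x \<noteq> 0; \<phi> k x' \<noteq> 0; d \<in> D\<rbrakk>
      \<Longrightarrow> \<bar>(x - x') \<bullet> d\<bar> \<le> 2 / real j + ((x \<bullet> d)\<^sup>2 + (x' \<bullet> d)\<^sup>2) / real j"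
proof
  let ?I = "PiE D (\<lambda>_. {..2 * j\<^sup>2})" and ?\<phi> = "\<lambda>k x. \<Prod>d\<in>D. tent j (k d) (x \<bullet> d)"
  have "(\<Sum>k\<in>?I. ?\<phi> k x) = 1" for x
    using prod_sum_PiE[OF assms(1), of "\<lambda>_. {..2 * j\<^sup>2}" "\<lambda>d k. tent j k (x \<bullet> d)"]
    by (simp add: sum_tent)
  moreover have "seq_weakly_continuous (?\<phi> k)" for k
    by (intro seq_weakly_continuous_prod seq_weakly_continuous_inner continuous_on_tent)
  ultimately show "weak_partition ?I ?\<phi>"
    using assms by (auto simp: weak_partition_def finite_PiE intro!: prod_nonneg tent_nonneg)
  show "\<bar>(x - x') \<bullet> d\<bar> \<le> 2 / real j + ((x \<bullet> d)\<^sup>2 + (x' \<bullet> d)\<^sup>2) / real j"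
    if "k \<in> ?I" "?\<phi> k x \<noteq> 0" "?\<phi> k x' \<noteq> 0" "d \<in> D" for k x x' d
    using that assms unfolding inner_diff_left by (intro tent_common_support) auto
qed

section \<open>Block couplings\<close>

text \<open>
  With \<open>p\<^sub>k = \<integral>\<phi>\<^sub>k d\<mu>\<close> and \<open>q\<^sub>k = \<integral>\<phi>\<^sub>k d\<nu>\<close>, the density \<open>\<Sum>\<^sub>k \<phi>\<^sub>k(x) \<phi>\<^sub>k(x') / max p\<^sub>k q\<^sub>k\<close> with
  respect to \<open>\<mu> \<otimes> \<nu>\<close> couples the masses \<open>min p\<^sub>k q\<^sub>k\<close> within each block; the rest is coupled independently.
  The conventions \<open>1 / 0 = 0\<close> are harmless: \<open>\<phi>\<^sub>k\<close> is null for both measures if \<open>max p\<^sub>k q\<^sub>k = 0\<close>, and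
  the rest is null if the overlap is \<open>1\<close>.
\<close>

definition block_weight :: "('b \<Rightarrow> 'a \<Rightarrow> real) \<Rightarrow> 'a measure \<Rightarrow> 'a measure \<Rightarrow> 'b \<Rightarrow> real" where
  "block_weight \<phi> \<mu> \<nu> k = 1 / max (\<integral>x. \<phi> k x \<partial>\<mu>) (\<integral>x. \<phi> k x \<partial>\<nu>)"

definition block_overlap :: "'b set \<Rightarrow> ('b \<Rightarrow> 'a \<Rightarrow> real) \<Rightarrow> 'a measure \<Rightarrow> 'a measure \<Rightarrow> real" where
  "block_overlap I \<phi> \<mu> \<nu> = (\<Sum>k\<in>I. min (\<integral>x. \<phi> k x \<partial>\<mu>) (\<integral>x. \<phi> k x \<partial>\<nu>))"

definition block_diag :: "'b set \<Rightarrow> ('b \<Rightarrow> 'a \<Rightarrow> real) \<Rightarrow> 'a measure \<Rightarrow> 'a measure \<Rightarrow> 'a \<Rightarrow> 'a \<Rightarrow> real" where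
  "block_diag I \<phi> \<mu> \<nu> x x' = (\<Sum>k\<in>I. block_weight \<phi> \<mu> \<nu> k * \<phi> k x * \<phi> k x')"

definition block_marginal :: "'b set \<Rightarrow> ('b \<Rightarrow> 'a \<Rightarrow> real) \<Rightarrow> 'a measure \<Rightarrow> 'a measure \<Rightarrow> 'a \<Rightarrow> real" where
  "block_marginal I \<phi> \<mu> \<nu> x = (\<Sum>k\<in>I. block_weight \<phi> \<mu> \<nu> k * (\<integral>x. \<phi> k x \<partial>\<nu>) * \<phi> k x)"

definition block_rest :: "'b set \<Rightarrow> ('b \<Rightarrow> 'a \<Rightarrow> real) \<Rightarrow> 'a measure \<Rightarrow> 'a measure \<Rightarrow> 'a \<Rightarrow> 'a \<Rightarrow> real" where
  "block_rest I \<phi> \<mu> \<nu> x x' =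
     (1 - block_marginal I \<phi> \<mu> \<nu> x) * (1 - block_marginal I \<phi> \<nu> \<mu> x') / (1 - block_overlap I \<phi> \<mu> \<nu>)"

lemma block_commute:
  "block_weight \<phi> \<nu> \<mu> k = block_weight \<phi> \<mu> \<nu> k"
  "block_overlap I \<phi> \<nu> \<mu> = block_overlap I \<phi> \<mu> \<nu>"
  "block_diag I \<phi> \<nu> \<mu> x' x = block_diag I \<phi> \<mu> \<nu> x x'"
  "block_rest I \<phi> \<nu> \<mu> x' x = block_rest I \<phi> \<mu> \<nu> x x'"
proof -
  show w: "block_weight \<phi> \<nu> \<mu> k = block_weight \<phi> \<mu> \<nu> k" for k
    unfolding block_weight_def by (subst max.commute) (rule refl)
  show o: "block_overlap I \<phi> \<nu> \<mu> = block_overlap I \<phi> \<mu> \<nu>"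
    unfolding block_overlap_def by (subst min.commute) (rule refl)
  show "block_diag I \<phi> \<nu> \<mu> x' x = block_diag I \<phi> \<mu> \<nu> x x'"
    unfolding block_diag_def w by (intro sum.cong refl) simp
  show "block_rest I \<phi> \<nu> \<mu> x' x = block_rest I \<phi> \<mu> \<nu> x x'"
    unfolding block_rest_def o by simp
qed

locale partitioned_pair =
  fixes I and \<phi> :: "'b \<Rightarrow> 'a::{real_inner, complete_space, second_countable_topology} \<Rightarrow> real"
    and \<mu> \<nu> :: "'a measure"
  assumes partition: "weak_partition I \<phi>"
    and prob: "prob_space \<mu>" "prob_space \<nu>"
    and sets[measurable_cong]: "sets \<mu> = sets borel" "sets \<nu> = sets borel"
begin

lemma swapped: "partitioned_pair I \<phi> \<nu> \<mu>"
  by (rule partitioned_pair.intro[OF partition prob(2,1) sets(2,1)])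

lemma phi_nonneg: "k \<in> I \<Longrightarrow> 0 \<le> \<phi> k x"
  and phi_sum: "(\<Sum>k\<in>I. \<phi> k x) = 1"
  and phi_measurable: "k \<in> I \<Longrightarrow> \<phi> k \<in> borel_measurable borel"
  using partition borel_measurable_seq_weakly_continuous by (auto simp: weak_partition_def)

lemma phi_integrable:
  assumes "k \<in> I" shows "integrable \<mu> (\<phi> k)" "integrable \<nu> (\<phi> k)"
  using assms prob phi_measurable weak_partition_le_1[OF partition assms] phi_nonneg
  by (auto intro!: finite_measure.integrable_const_bound[where B=1] prob_space.finite_measure
      simp: measurable_cong_sets[OF sets(1) refl] measurable_cong_sets[OF sets(2) refl])

lemma integral_nonneg: "k \<in> I \<Longrightarrow> 0 \<le> (\<integral>x. \<phi> k x \<partial>\<mu>)" "k \<in> I \<Longrightarrow> 0 \<le> (\<integral>x. \<phi> k x \<partial>\<nu>)"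
  by (simp_all add: phi_nonneg)

lemma weight_nonneg: "k \<in> I \<Longrightarrow> 0 \<le> block_weight \<phi> \<mu> \<nu> k"
  using integral_nonneg by (simp add: block_weight_def le_max_iff_disj)

lemma weight_mult_le_1: "k \<in> I \<Longrightarrow> block_weight \<phi> \<mu> \<nu> k * (\<integral>x. \<phi> k x \<partial>\<nu>) \<le> 1"
  using integral_nonneg by (auto simp: block_weight_def divide_le_eq max_def less_le)

text \<open>This is \<open>p * q / max p q = min p q\<close>, valid also for
  \<open>p = q = 0\<close> under the convention for division. It makes \<open>block_overlap\<close>
  the mass of the part coupled within blocks.\<close>

lemma weight_mult_mult:
  "k \<in> I \<Longrightarrow> block_weight \<phi> \<mu> \<nu> k * (\<integral>x. \<phi> k x \<partial>\<nu>) * (\<integral>x. \<phi> k x \<partial>\<mu>)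
     = min (\<integral>x. \<phi> k x \<partial>\<mu>) (\<integral>x. \<phi> k x \<partial>\<nu>)"
  using integral_nonneg[of k] by (auto simp: block_weight_def max_def min_def)

lemma diag_nonneg: "0 \<le> block_diag I \<phi> \<mu> \<nu> x x'"
  unfolding block_diag_def by (intro sum_nonneg mult_nonneg_nonneg weight_nonneg phi_nonneg)

lemma diag_support:
  assumes "block_diag I \<phi> \<mu> \<nu> x x' \<noteq> 0"
  obtains k where "k \<in> I" "\<phi> k x \<noteq> 0" "\<phi> k x' \<noteq> 0"
  using assms unfolding block_diag_def by (auto elim: sum.not_neutral_contains_not_neutral)

lemma diag_measurable: "(\<lambda>z. block_diag I \<phi> \<mu> \<nu> (fst z) (snd z)) \<in> borel_measurable (borel \<Otimes>\<^sub>M borel)"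
  unfolding block_diag_def using phi_measurable
    by (auto intro!: borel_measurable_sum borel_measurable_times
      measurable_compose[OF measurable_fst] measurable_compose[OF measurable_snd])

lemma marginal_measurable: "block_marginal I \<phi> \<mu> \<nu> \<in> borel_measurable borel"
  unfolding block_marginal_def using phi_measurable by (intro borel_measurable_sum) auto

text \<open>The value is an average, with weights \<open>\<phi> k x\<close>, of numbers that are at
  most 1. It keeps the factors of \<open>block_rest\<close> nonnegative.\<close>

lemma marginal_le_1: "block_marginal I \<phi> \<mu> \<nu> x \<le> 1"
proof -
  have "block_marginal I \<phi> \<mu> \<nu> x \<le> (\<Sum>k\<in>I. 1 * \<phi> k x)"
    unfolding block_marginal_def
    by (intro sum_mono mult_right_mono weight_mult_le_1 phi_nonneg)
  then show ?thesis by (simp add: phi_sum)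
qed

lemma marginal_integrable: "integrable \<mu> (block_marginal I \<phi> \<mu> \<nu>)"
  unfolding block_marginal_def using phi_integrable
    by (intro Bochner_Integration.integrable_sum integrable_mult_right) auto

lemma integral_marginal: "(\<integral>x. block_marginal I \<phi> \<mu> \<nu> x \<partial>\<mu>) = block_overlap I \<phi> \<mu> \<nu>"
  unfolding block_marginal_def block_overlap_def using phi_integrable
  by (subst Bochner_Integration.integral_sum) (auto simp: weight_mult_mult intro!: sum.cong)

text \<open>This justifies the name \<open>block_marginal\<close>: it is the density with respect to
  \<open>\<mu>\<close> of the first marginal of the block-diagonal part. The second marginal follows
  through \<open>swapped\<close>.\<close>

lemma integral_diag:
  "integrable \<nu> (block_diag I \<phi> \<mu> \<nu> x)"
  "(\<integral>x'. block_diag I \<phi> \<mu> \<nu> x x' \<partial>\<nu>) = block_marginal I \<phi> \<mu> \<nu> x"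
proof -
  show "integrable \<nu> (block_diag I \<phi> \<mu> \<nu> x)"
    unfolding block_diag_def using phi_integrable
      by (intro Bochner_Integration.integrable_sum integrable_mult_right) auto
  show "(\<integral>x'. block_diag I \<phi> \<mu> \<nu> x x' \<partial>\<nu>) = block_marginal I \<phi> \<mu> \<nu> x"
    unfolding block_diag_def block_marginal_def using phi_integrable
    by (subst Bochner_Integration.integral_sum) (auto intro!: sum.cong)
qed

lemma overlap_le_1: "block_overlap I \<phi> \<mu> \<nu> \<le> 1"
  using prob_space.integral_le_const[OF prob(1) marginal_integrable, of 1] marginal_le_1
  by (simp add: integral_marginal)

lemma rest_nonneg: "0 \<le> block_rest I \<phi> \<mu> \<nu> x x'"
  unfolding block_rest_def using marginal_le_1 overlap_le_1 partitioned_pair.marginal_le_1[OF swapped]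
  by simp

lemma rest_measurable: "(\<lambda>z. block_rest I \<phi> \<mu> \<nu> (fst z) (snd z)) \<in> borel_measurable (borel \<Otimes>\<^sub>M borel)"
  unfolding block_rest_def using marginal_measurable partitioned_pair.marginal_measurable[OF swapped]
  by (auto intro!: borel_measurable_divide borel_measurable_times borel_measurable_diff
      measurable_compose[OF measurable_fst] measurable_compose[OF measurable_snd])

text \<open>The second factor of \<open>block_rest\<close> integrates to
  \<open>1 - block_overlap I \<phi> \<mu> \<nu>\<close>, which cancels the denominator. For full
  overlap the quotient is 0 by convention, hence the case distinction.\<close>

lemma integral_rest:
  "integrable \<nu> (block_rest I \<phi> \<mu> \<nu> x)"
  "(\<integral>x'. block_rest I \<phi> \<mu> \<nu> x x' \<partial>\<nu>) =
     (if block_overlap I \<phi> \<mu> \<nu> = 1 then 0 else 1 - block_marginal I \<phi> \<mu> \<nu> x)"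
proof -
  interpret \<nu>: prob_space \<nu> by (rule prob)
  note i = partitioned_pair.marginal_integrable[OF swapped]
  show "integrable \<nu> (block_rest I \<phi> \<mu> \<nu> x)"
    unfolding block_rest_def using i by auto
  have "(\<integral>x'. block_rest I \<phi> \<mu> \<nu> x x' \<partial>\<nu>) =
      (1 - block_marginal I \<phi> \<mu> \<nu> x) * (1 - block_overlap I \<phi> \<mu> \<nu>) / (1 - block_overlap I \<phi> \<mu> \<nu>)"
    unfolding block_rest_def using i partitioned_pair.integral_marginal[OF swapped]
    by (simp add: block_commute \<nu>.prob_space)
  then show "(\<integral>x'. block_rest I \<phi> \<mu> \<nu> x x' \<partial>\<nu>) =
     (if block_overlap I \<phi> \<mu> \<nu> = 1 then 0 else 1 - block_marginal I \<phi> \<mu> \<nu> x)"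
    by simp
qed

text \<open>A function bounded by 1 with integral 1 over a probability measure equals 1 almost
  everywhere. So with full overlap the vanishing rest leaves no mass uncoupled.\<close>

lemma AE_marginal_eq_1:
  assumes "block_overlap I \<phi> \<mu> \<nu> = 1"
  shows "AE x in \<mu>. block_marginal I \<phi> \<mu> \<nu> x = 1"
proof -
  interpret \<mu>: prob_space \<mu> by (rule prob)
  have "(\<integral>x. 1 - block_marginal I \<phi> \<mu> \<nu> x \<partial>\<mu>) = 0"
    using marginal_integrable integral_marginal assms by (simp add: \<mu>.prob_space)
  then have "AE x in \<mu>. 1 - block_marginal I \<phi> \<mu> \<nu> x = 0"
    by (subst (asm) integral_nonneg_eq_0_iff_AE) (use marginal_integrable marginal_le_1 in auto)
  then show ?thesis by simp
qed

text \<open>The diagonal part contributes \<open>block_marginal\<close> and the rest its complement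
  to 1. The claim is almost sure because with full overlap the rest is 0 everywhere while the
  marginal is known to be 1 only almost everywhere.\<close>

lemma AE_integral_diag_rest:
  "AE x in \<mu>. (\<integral>\<^sup>+x'. ennreal (block_diag I \<phi> \<mu> \<nu> x x' + block_rest I \<phi> \<mu> \<nu> x x') \<partial>\<nu>) = 1"
proof -
  have "AE x in \<mu>. block_marginal I \<phi> \<mu> \<nu> x + (\<integral>x'. block_rest I \<phi> \<mu> \<nu> x x' \<partial>\<nu>) = 1"
    using AE_marginal_eq_1 by (cases "block_overlap I \<phi> \<mu> \<nu> = 1") (simp_all add: integral_rest)
  then show ?thesis
    by eventually_elim (simp add: nn_integral_eq_integral integral_diag integral_rest diag_nonneg
        rest_nonneg del: ennreal_plus)
qed

text \<open>Only the mass of the rest may join points that share no block. In the application the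
  overlap tends to 1, so this mass vanishes.\<close>

lemma integral_integral_rest:
  "(\<integral>\<^sup>+x. \<integral>\<^sup>+x'. ennreal (block_rest I \<phi> \<mu> \<nu> x x') \<partial>\<nu> \<partial>\<mu>) = ennreal (1 - block_overlap I \<phi> \<mu> \<nu>)"
proof (cases "block_overlap I \<phi> \<mu> \<nu> = 1")
  case True
  then show ?thesis
    by (simp add: nn_integral_eq_integral integral_rest rest_nonneg)
next
  case False
  interpret \<mu>: prob_space \<mu> by (rule prob)
  have "(\<integral>\<^sup>+x. \<integral>\<^sup>+x'. ennreal (block_rest I \<phi> \<mu> \<nu> x x') \<partial>\<nu> \<partial>\<mu>)
      = (\<integral>\<^sup>+x. ennreal (1 - block_marginal I \<phi> \<mu> \<nu> x) \<partial>\<mu>)"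
    using False by (simp add: nn_integral_eq_integral integral_rest rest_nonneg)
  also have "\<dots> = ennreal (1 - block_overlap I \<phi> \<mu> \<nu>)"
    using marginal_integrable marginal_le_1
    by (subst nn_integral_eq_integral) (auto simp: integral_marginal \<mu>.prob_space)
  finally show ?thesis .
qed

end

section \<open>Gluing\<close>

lemma borel_measurable_fst [measurable]:
  "fst \<in> borel_measurable (borel :: ('a::topological_space \<times> 'b::topological_space) measure)"
  by (intro borel_measurable_continuous_onI continuous_intros)

lemma borel_measurable_snd [measurable]:
  "snd \<in> borel_measurable (borel :: ('a::topological_space \<times> 'b::topological_space) measure)"
  by (intro borel_measurable_continuous_onI continuous_intros)

lemma couplingsD:
  assumes "\<gamma> \<in> couplings \<mu> \<nu>"
  shows "prob_space \<gamma>" "sets \<gamma> = sets borel" "distr \<gamma> borel fst = \<mu>" "distr \<gamma> borel snd = \<nu>"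
  using assms by (auto simp: couplings_def)

context partitioned_pair
begin

text \<open>A point is \<open>((x, y), x')\<close>. The density sees only \<open>x\<close> and
  \<open>x'\<close>, so for \<open>\<gamma>\<close> with first marginal \<open>\<mu>\<close> the
  block coupling of \<open>\<mu>\<close> and \<open>\<nu>\<close> is attached to
  \<open>\<gamma>\<close> along \<open>x\<close>, and \<open>y\<close> and \<open>x'\<close> are
  conditionally independent given \<open>x\<close>.\<close>

definition glue :: "('a \<times> 'a) measure \<Rightarrow> (('a \<times> 'a) \<times> 'a) measure" where
  "glue \<gamma> = density (\<gamma> \<Otimes>\<^sub>M \<nu>)
     (\<lambda>w. ennreal (block_diag I \<phi> \<mu> \<nu> (fst (fst w)) (snd w) + block_rest I \<phi> \<mu> \<nu> (fst (fst w)) (snd w)))"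

lemma sets_pair_borel:
  fixes \<gamma> :: "('a \<times> 'a) measure"
  assumes "sets \<gamma> = sets borel"
  shows "sets (\<gamma> \<Otimes>\<^sub>M \<nu>) = sets ((borel \<Otimes>\<^sub>M borel) \<Otimes>\<^sub>M borel)"
  unfolding borel_prod[where 'a='a and 'b='a] by (rule sets_pair_measure_cong[OF assms sets(2)])

lemma sets_glue:
  assumes "sets \<gamma> = sets borel"
  shows "sets (glue \<gamma>) = sets borel"
  unfolding glue_def sets_density sets_pair_borel[OF assms] borel_prod ..

lemma density_measurable:
  fixes \<gamma> :: "('a \<times> 'a) measure"
  assumes "sets \<gamma> = sets borel"
  shows "(\<lambda>w. block_diag I \<phi> \<mu> \<nu> (fst (fst w)) (snd w)) \<in> borel_measurable (\<gamma> \<Otimes>\<^sub>M \<nu>)"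
    "(\<lambda>w. block_rest I \<phi> \<mu> \<nu> (fst (fst w)) (snd w)) \<in> borel_measurable (\<gamma> \<Otimes>\<^sub>M \<nu>)"
proof -
  have *: "(\<lambda>w. (fst (fst w), snd w)) \<in> \<gamma> \<Otimes>\<^sub>M \<nu> \<rightarrow>\<^sub>M borel \<Otimes>\<^sub>M borel"
    using sets_pair_borel[OF assms] by (subst measurable_cong_sets[OF _ refl]) auto
  show "(\<lambda>w. block_diag I \<phi> \<mu> \<nu> (fst (fst w)) (snd w)) \<in> borel_measurable (\<gamma> \<Otimes>\<^sub>M \<nu>)"
    using measurable_compose[OF * diag_measurable] by simp
  show "(\<lambda>w. block_rest I \<phi> \<mu> \<nu> (fst (fst w)) (snd w)) \<in> borel_measurable (\<gamma> \<Otimes>\<^sub>M \<nu>)"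
    using measurable_compose[OF * rest_measurable] by simp
qed

text \<open>By Fubini it suffices that the density integrates to 1 in either variable. Over
  \<open>x'\<close> this holds for almost every \<open>x\<close> under \<open>\<mu>\<close>, hence
  for almost every pair under \<open>\<gamma>\<close>. Over the pair only its first coordinate
  enters, so the integral is one over \<open>\<mu>\<close> and the swapped statement
  applies.\<close>

lemma distr_glue:
  assumes \<gamma>: "\<gamma> \<in> couplings \<mu> \<rho>"
  shows "distr (glue \<gamma>) borel fst = \<gamma>" "distr (glue \<gamma>) borel snd = \<nu>"
proof -
  interpret \<gamma>: prob_space \<gamma> by (rule couplingsD[OF \<gamma>])
  interpret \<nu>: prob_space \<nu> by (rule prob)
  interpret pair_sigma_finite \<gamma> \<nu> ..
  note [measurable_cong] = couplingsD(2)[OF \<gamma>]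
  note [measurable] = density_measurable[OF couplingsD(2)[OF \<gamma>]]
  let ?G = "\<lambda>x x'. ennreal (block_diag I \<phi> \<mu> \<nu> x x' + block_rest I \<phi> \<mu> \<nu> x x')"
  have G[measurable]: "(\<lambda>w. ?G (fst (fst w)) (snd w)) \<in> borel_measurable (\<gamma> \<Otimes>\<^sub>M \<nu>)"
    by measurable
  have AE1: "AE z in \<gamma>. (\<integral>\<^sup>+x'. ?G (fst z) x' \<partial>\<nu>) = 1"
    using AE_integral_diag_rest unfolding couplingsD(3)[OF \<gamma>, symmetric]
    by (rule AE_distrD[rotated]) measurable
  have AE2: "AE x' in \<nu>. (\<integral>\<^sup>+z. ?G (fst z) x' \<partial>\<gamma>) = 1"
  proof -
    have "(\<integral>\<^sup>+z. ?G (fst z) x' \<partial>\<gamma>) = (\<integral>\<^sup>+x. ?G x x' \<partial>\<mu>)" for x'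
    proof -
      have "(\<lambda>x. block_diag I \<phi> \<mu> \<nu> x x' + block_rest I \<phi> \<mu> \<nu> x x') \<in> borel_measurable borel"
        using measurable_compose[OF measurable_Pair2' diag_measurable] measurable_compose[OF
          measurable_Pair2' rest_measurable]
        by (intro borel_measurable_add) auto
      then show ?thesis
        unfolding couplingsD(3)[OF \<gamma>, symmetric] by (subst nn_integral_distr) auto
    qed
    then show ?thesis
      using partitioned_pair.AE_integral_diag_rest[OF swapped] by (simp add: block_commute)
  qed
  show "distr (glue \<gamma>) borel fst = \<gamma>"
  proof (rule measure_eqI)
    fix S assume "S \<in> sets (distr (glue \<gamma>) borel fst)"
    then have S[measurable]: "S \<in> sets borel" by simp
    then have S'[measurable]: "S \<in> sets \<gamma>" using couplingsD(2)[OF \<gamma>] by simp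
    have "emeasure (distr (glue \<gamma>) borel fst) S = (\<integral>\<^sup>+z. indicator S z \<partial>distr (glue \<gamma>) borel fst)"
      by simp
    also have "\<dots> = (\<integral>\<^sup>+w. indicator S (fst w) \<partial>glue \<gamma>)"
      by (subst nn_integral_distr) (auto simp: glue_def)
    also have "\<dots> = (\<integral>\<^sup>+w. ?G (fst (fst w)) (snd w) * indicator S (fst w) \<partial>(\<gamma> \<Otimes>\<^sub>M \<nu>))"
      unfolding glue_def by (subst nn_integral_density) auto
    also have "\<dots> = (\<integral>\<^sup>+z. \<integral>\<^sup>+x'. ?G (fst z) x' * indicator S z \<partial>\<nu> \<partial>\<gamma>)"
      by (subst \<nu>.nn_integral_fst[symmetric]) auto
    also have "\<dots> = (\<integral>\<^sup>+z. (\<integral>\<^sup>+x'. ?G (fst z) x' \<partial>\<nu>) * indicator S z \<partial>\<gamma>)"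
      by (intro nn_integral_cong nn_integral_multc) (use measurable_compose[OF measurable_Pair1' G]
        in auto)
    also have "\<dots> = (\<integral>\<^sup>+z. indicator S z \<partial>\<gamma>)"
      by (intro nn_integral_cong_AE) (use AE1 in auto)
    finally show "emeasure (distr (glue \<gamma>) borel fst) S = emeasure \<gamma> S" by simp
  qed (simp add: couplingsD[OF \<gamma>])
  show "distr (glue \<gamma>) borel snd = \<nu>"
  proof (rule measure_eqI)
    fix S assume "S \<in> sets (distr (glue \<gamma>) borel snd)"
    then have S[measurable]: "S \<in> sets borel" by simp
    then have S'[measurable]: "S \<in> sets \<nu>" using sets(2) by simp
    have "emeasure (distr (glue \<gamma>) borel snd) S = (\<integral>\<^sup>+z. indicator S z \<partial>distr (glue \<gamma>) borel snd)"
      by simp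
    also have "\<dots> = (\<integral>\<^sup>+w. indicator S (snd w) \<partial>glue \<gamma>)"
      by (subst nn_integral_distr) (auto simp: glue_def)
    also have "\<dots> = (\<integral>\<^sup>+w. ?G (fst (fst w)) (snd w) * indicator S (snd w) \<partial>(\<gamma> \<Otimes>\<^sub>M \<nu>))"
      unfolding glue_def by (subst nn_integral_density) auto
    also have "\<dots> = (\<integral>\<^sup>+x'. \<integral>\<^sup>+z. ?G (fst z) x' * indicator S x' \<partial>\<gamma> \<partial>\<nu>)"
      by (subst nn_integral_snd[symmetric]) auto
    also have "\<dots> = (\<integral>\<^sup>+x'. (\<integral>\<^sup>+z. ?G (fst z) x' \<partial>\<gamma>) * indicator S x' \<partial>\<nu>)"
      by (intro nn_integral_cong nn_integral_multc) (use measurable_compose[OF measurable_Pair2' G]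
        in auto)
    also have "\<dots> = (\<integral>\<^sup>+x'. indicator S x' \<partial>\<nu>)"
      by (intro nn_integral_cong_AE) (use AE2 in auto)
    finally show "emeasure (distr (glue \<gamma>) borel snd) S = emeasure \<nu> S" by simp
  qed (simp add: sets)
qed

lemma prob_space_glue:
  assumes "\<gamma> \<in> couplings \<mu> \<rho>"
  shows "prob_space (glue \<gamma>)"
proof (rule prob_space_distrD)
  show "fst \<in> glue \<gamma> \<rightarrow>\<^sub>M borel"
    using sets_glue[OF couplingsD(2)[OF assms]] by (subst measurable_cong_sets[OF _ refl]) auto
  show "prob_space (distr (glue \<gamma>) borel fst)"
    using couplingsD(1)[OF assms] distr_glue(1)[OF assms] by simp
qed

text \<open>Where the diagonal density is positive the points share a block and \<open>T\<close> is
  dominated by \<open>U\<close>; elsewhere only the rest carries mass, and the surcharge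
  \<open>c\<close> is paid on at most the mass of the rest.\<close>

lemma nn_integral_glue_le:
  fixes T U :: "'a \<Rightarrow> 'a \<Rightarrow> ennreal"
  assumes \<gamma>: "\<gamma> \<in> couplings \<mu> \<rho>"
    and T: "(\<lambda>z. T (fst z) (snd z)) \<in> borel_measurable borel"
    and U: "(\<lambda>z. U (fst z) (snd z)) \<in> borel_measurable borel"
    and diag: "\<And>k x x'. \<lbrakk>k \<in> I; \<phi> k x \<noteq> 0; \<phi> k x' \<noteq> 0\<rbrakk> \<Longrightarrow> T x x' \<le> U x x'"
    and rest: "\<And>x x'. T x x' \<le> U x x' + c"
  shows "(\<integral>\<^sup>+w. T (fst (fst w)) (snd w) \<partial>glue \<gamma>)
    \<le> (\<integral>\<^sup>+w. U (fst (fst w)) (snd w) \<partial>glue \<gamma>) + c * ennreal (1 - block_overlap I \<phi> \<mu> \<nu>)"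
proof -
  interpret \<gamma>: prob_space \<gamma> by (rule couplingsD[OF \<gamma>])
  interpret \<nu>: prob_space \<nu> by (rule prob)
  interpret pair_sigma_finite \<gamma> \<nu> ..
  note [measurable_cong] = couplingsD(2)[OF \<gamma>]
  note [measurable] = density_measurable[OF couplingsD(2)[OF \<gamma>]]
  let ?d = "\<lambda>w. ennreal (block_diag I \<phi> \<mu> \<nu> (fst (fst w)) (snd w))"
  let ?r = "\<lambda>w. ennreal (block_rest I \<phi> \<mu> \<nu> (fst (fst w)) (snd w))"
  have sets_eq: "sets (\<gamma> \<Otimes>\<^sub>M \<nu>) = sets ((borel \<Otimes>\<^sub>M borel) \<Otimes>\<^sub>M borel)"
    by (rule sets_pair_borel[OF couplingsD(2)[OF \<gamma>]])
  have XZ: "(\<lambda>w. (fst (fst w), snd w)) \<in> \<gamma> \<Otimes>\<^sub>M \<nu> \<rightarrow>\<^sub>M borel"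
    unfolding borel_prod[symmetric] using sets_eq by (subst measurable_cong_sets[OF _ refl]) auto
  have [measurable]: "(\<lambda>w. T (fst (fst w)) (snd w)) \<in> borel_measurable (\<gamma> \<Otimes>\<^sub>M \<nu>)"
    "(\<lambda>w. U (fst (fst w)) (snd w)) \<in> borel_measurable (\<gamma> \<Otimes>\<^sub>M \<nu>)"
    using measurable_compose[OF XZ T] measurable_compose[OF XZ U] by simp_all
  have "(\<integral>\<^sup>+w. T (fst (fst w)) (snd w) \<partial>glue \<gamma>)
      = (\<integral>\<^sup>+w. (?d w + ?r w) * T (fst (fst w)) (snd w) \<partial>(\<gamma> \<Otimes>\<^sub>M \<nu>))"
    unfolding glue_def by (subst nn_integral_density) (auto simp: diag_nonneg rest_nonneg)
  also have "\<dots> \<le> (\<integral>\<^sup>+w. (?d w + ?r w) * U (fst (fst w)) (snd w) + c * ?r w \<partial>(\<gamma> \<Otimes>\<^sub>M \<nu>))"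
  proof (intro nn_integral_mono)
    fix w
    show "(?d w + ?r w) * T (fst (fst w)) (snd w) \<le> (?d w + ?r w) * U (fst (fst w)) (snd w) + c * ?r w"
    \<comment> \<open>If the diagonal density is nonzero at the point, a common block exists and
      \<open>T\<close> is at most \<open>U\<close> there, which also settles the contribution of the
      rest at that point.\<close>
    proof (cases "block_diag I \<phi> \<mu> \<nu> (fst (fst w)) (snd w) = 0")
      case True
      have "?r w * T (fst (fst w)) (snd w) \<le> ?r w * (U (fst (fst w)) (snd w) + c)"
        by (intro mult_left_mono rest) auto
      also have "\<dots> = ?r w * U (fst (fst w)) (snd w) + c * ?r w"
        by (simp only: distrib_left mult.commute[of c])
      finally show ?thesis using True by simp
    next
      case False
      then have "T (fst (fst w)) (snd w) \<le> U (fst (fst w)) (snd w)"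
        by (metis diag_support diag)
      then show ?thesis by (intro add_increasing2 mult_left_mono) auto
    qed
  qed
  also have "\<dots> = (\<integral>\<^sup>+w. (?d w + ?r w) * U (fst (fst w)) (snd w) \<partial>(\<gamma> \<Otimes>\<^sub>M \<nu>))
      + c * (\<integral>\<^sup>+w. ?r w \<partial>(\<gamma> \<Otimes>\<^sub>M \<nu>))"
    by (subst nn_integral_add) (auto simp: nn_integral_cmult)
  also have "(\<integral>\<^sup>+w. (?d w + ?r w) * U (fst (fst w)) (snd w) \<partial>(\<gamma> \<Otimes>\<^sub>M \<nu>))
      = (\<integral>\<^sup>+w. U (fst (fst w)) (snd w) \<partial>glue \<gamma>)"
    unfolding glue_def by (subst nn_integral_density) (auto simp: diag_nonneg rest_nonneg)
  also have "(\<integral>\<^sup>+w. ?r w \<partial>(\<gamma> \<Otimes>\<^sub>M \<nu>)) = (\<integral>\<^sup>+z. \<integral>\<^sup>+x'. ennreal (block_rest I \<phi> \<mu> \<nu> (fst z) x') \<partial>\<nu> \<partial>\<gamma>)"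
    by (subst \<nu>.nn_integral_fst[symmetric]) auto
  also have "\<dots> = (\<integral>\<^sup>+x. \<integral>\<^sup>+x'. ennreal (block_rest I \<phi> \<mu> \<nu> x x') \<partial>\<nu> \<partial>\<mu>)"
  proof -
    have "(\<lambda>w. block_rest I \<phi> \<mu> \<nu> (fst w) (snd w)) \<in> borel_measurable (borel \<Otimes>\<^sub>M \<nu>)"
      using rest_measurable sets(2) by (subst measurable_cong_sets[OF sets_pair_measure_cong refl]) auto
    then have "(\<lambda>x. \<integral>\<^sup>+x'. ennreal (block_rest I \<phi> \<mu> \<nu> x x') \<partial>\<nu>) \<in> borel_measurable borel"
      by (intro \<nu>.borel_measurable_nn_integral) (simp add: case_prod_beta')
    then show ?thesis
      unfolding couplingsD(3)[OF \<gamma>, symmetric] by (subst nn_integral_distr) auto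
  qed
  finally show ?thesis by (simp add: integral_integral_rest)
qed

end

section \<open>The Wasserstein distance\<close>

lemma P2D:
  assumes "\<mu> \<in> P2"
  shows "prob_space \<mu>" "sets \<mu> = sets borel" "integrable \<mu> (\<lambda>x. (norm x)\<^sup>2)"
  using assms by (auto simp: P2_def)

lemma norm_diff_square_le:
  fixes x y :: "'a::real_inner"
  shows "(norm (x - y))\<^sup>2 \<le> 2 * ((norm x)\<^sup>2 + (norm y)\<^sup>2)"
proof -
  have "(norm (x - y))\<^sup>2 + (norm (x + y))\<^sup>2 = 2 * ((norm x)\<^sup>2 + (norm y)\<^sup>2)"
    by (simp add: power2_norm_eq_inner inner_diff inner_add inner_commute)
  then show ?thesis by (smt (verit) zero_le_power2)
qed

lemma integral_distr_P2:
  assumes "\<mu> \<in> P2" "f \<in> borel_measurable M" "distr M borel f = \<mu>"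
  shows "integrable M (\<lambda>w. (norm (f w))\<^sup>2)" "(\<integral>w. (norm (f w))\<^sup>2 \<partial>M) = (\<integral>x. (norm x)\<^sup>2 \<partial>\<mu>)"
  using P2D(3)[OF assms(1)] assms(2) unfolding assms(3)[symmetric]
  by (auto simp: integrable_distr_eq integral_distr)

lemma integrable_norm_diff_square:
  fixes f g :: "'b \<Rightarrow> 'a::{real_inner, second_countable_topology}"
  assumes [measurable]: "f \<in> borel_measurable M" "g \<in> borel_measurable M"
    and "integrable M (\<lambda>w. (norm (f w))\<^sup>2)" "integrable M (\<lambda>w. (norm (g w))\<^sup>2)"
  shows "integrable M (\<lambda>w. (norm (f w - g w))\<^sup>2)"
  by (rule Bochner_Integration.integrable_bound[where f="\<lambda>w. 2 * ((norm (f w))\<^sup>2 + (norm (g w))\<^sup>2)"])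
    (use assms norm_diff_square_le in auto)

lemma coupling_integrable:
  assumes "\<mu> \<in> P2" "\<nu> \<in> P2" "\<gamma> \<in> couplings \<mu> \<nu>"
  shows "integrable \<gamma> (\<lambda>z. (norm (fst z - snd z))\<^sup>2)"
proof -
  note [measurable_cong] = couplingsD(2)[OF assms(3)]
  show ?thesis
    by (intro integrable_norm_diff_square integral_distr_P2(1)[OF assms(1)] integral_distr_P2(1)[OF
      assms(2)]
        couplingsD[OF assms(3)]) measurable
qed

lemma W2_square: "(W2 \<mu> \<nu>)\<^sup>2 = enn2real
     (INF \<gamma>\<in>couplings \<mu> \<nu>. \<integral>\<^sup>+ z. ennreal ((norm (fst z - snd z))\<^sup>2) \<partial>\<gamma>)"
  by (simp add: W2_def)

lemma W2_nonneg: "0 \<le> W2 \<mu> \<nu>"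
  by (simp add: W2_def)

lemma W2_square_le:
  assumes "\<mu> \<in> P2" "\<nu> \<in> P2" "\<gamma> \<in> couplings \<mu> \<nu>"
  shows "(W2 \<mu> \<nu>)\<^sup>2 \<le> (\<integral>z. (norm (fst z - snd z))\<^sup>2 \<partial>\<gamma>)"
proof -
  have "(INF \<gamma>\<in>couplings \<mu> \<nu>. \<integral>\<^sup>+ z. ennreal ((norm (fst z - snd z))\<^sup>2) \<partial>\<gamma>)
      \<le> ennreal (\<integral>z. (norm (fst z - snd z))\<^sup>2 \<partial>\<gamma>)"
    using assms(3) coupling_integrable[OF assms]
    by (subst nn_integral_eq_integral[symmetric]) (auto intro: INF_lower)
  from enn2real_mono[OF this] show ?thesis unfolding W2_square by simp
qed

text \<open>The pair \<open>(f, g)\<close> pushes \<open>M\<close> to a coupling. This allows any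
  two coordinates of a plan on triples to compete in the infimum.\<close>

lemma W2_square_le_distr:
  assumes "\<mu> \<in> P2" "\<nu> \<in> P2" "prob_space M"
    and [measurable]: "f \<in> borel_measurable M" "g \<in> borel_measurable M"
    and f: "distr M borel f = \<mu>" and g: "distr M borel g = \<nu>"
  shows "(W2 \<mu> \<nu>)\<^sup>2 \<le> (\<integral>w. (norm (f w - g w))\<^sup>2 \<partial>M)"
proof -
  have fg[measurable]: "(\<lambda>w. (f w, g w)) \<in> borel_measurable M"
    unfolding borel_prod[symmetric] by measurable
  let ?\<gamma> = "distr M borel (\<lambda>w. (f w, g w))"
  have "?\<gamma> \<in> couplings \<mu> \<nu>"
    unfolding couplings_def using f g
    by (auto simp: distr_distr comp_def intro!: prob_space.prob_space_distr assms)
  from W2_square_le[OF assms(1,2) this] show ?thesis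
    by (simp add: integral_distr)
qed

lemma pair_measure_coupling:
  assumes "\<mu> \<in> P2" "\<nu> \<in> P2"
  shows "\<mu> \<Otimes>\<^sub>M \<nu> \<in> couplings \<mu> \<nu>"
proof -
  interpret \<mu>: prob_space \<mu> by (rule P2D[OF assms(1)])
  interpret \<nu>: prob_space \<nu> by (rule P2D[OF assms(2)])
  interpret pair_prob_space \<mu> \<nu> ..
  have s: "sets (\<mu> \<Otimes>\<^sub>M \<nu>) = sets borel"
    unfolding borel_prod[symmetric] using P2D(2)[OF assms(1)] P2D(2)[OF assms(2)]
    by (rule sets_pair_measure_cong)
  have snd: "distr (\<mu> \<Otimes>\<^sub>M \<nu>) \<nu> snd = \<nu>"
  proof (rule measure_eqI)
    fix A assume "A \<in> sets (distr (\<mu> \<Otimes>\<^sub>M \<nu>) \<nu> snd)"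
    then have A: "A \<in> sets \<nu>" by simp
    then have "snd -` A \<inter> space (\<mu> \<Otimes>\<^sub>M \<nu>) = space \<mu> \<times> A"
      by (auto simp: space_pair_measure dest: sets.sets_into_space)
    then show "emeasure (distr (\<mu> \<Otimes>\<^sub>M \<nu>) \<nu> snd) A = emeasure \<nu> A"
      using A by (simp add: emeasure_distr \<nu>.emeasure_pair_measure_Times \<mu>.emeasure_space_1)
  qed simp
  have "distr (\<mu> \<Otimes>\<^sub>M \<nu>) borel fst = distr (\<mu> \<Otimes>\<^sub>M \<nu>) \<mu> fst"
    by (intro distr_cong) (simp_all add: P2D(2)[OF assms(1)])
  moreover have "distr (\<mu> \<Otimes>\<^sub>M \<nu>) borel snd = distr (\<mu> \<Otimes>\<^sub>M \<nu>) \<nu> snd"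
    by (intro distr_cong) (simp_all add: P2D(2)[OF assms(2)])
  ultimately show ?thesis
    unfolding couplings_def using s prob_space_axioms
    by (simp add: \<nu>.distr_pair_fst snd)
qed

text \<open>The product coupling has finite cost, so the infimum is finite and
  \<open>enn2real\<close> can be undone. A number strictly above an infimum then exceeds the cost of
  some coupling.\<close>

lemma W2_near_optimal:
  assumes "\<mu> \<in> P2" "\<nu> \<in> P2" "0 < e"
  obtains \<gamma> where "\<gamma> \<in> couplings \<mu> \<nu>" "(\<integral>z. (norm (fst z - snd z))\<^sup>2 \<partial>\<gamma>) < (W2 \<mu> \<nu>)\<^sup>2 + e"
proof -
  define m where "m = (INF \<gamma>\<in>couplings \<mu> \<nu>. \<integral>\<^sup>+ z. ennreal ((norm (fst z - snd z))\<^sup>2) \<partial>\<gamma>)"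
  have nn: "(\<integral>\<^sup>+ z. ennreal ((norm (fst z - snd z))\<^sup>2) \<partial>\<gamma>) = ennreal (\<integral>z. (norm (fst z - snd z))\<^sup>2 \<partial>\<gamma>)"
    if "\<gamma> \<in> couplings \<mu> \<nu>" for \<gamma>
    using coupling_integrable[OF assms(1,2) that] by (intro nn_integral_eq_integral) auto
  have "m \<le> ennreal (\<integral>z. (norm (fst z - snd z))\<^sup>2 \<partial>(\<mu> \<Otimes>\<^sub>M \<nu>))"
    unfolding m_def nn[OF pair_measure_coupling[OF assms(1,2)], symmetric]
    by (intro INF_lower pair_measure_coupling assms)
  then have "m < \<infinity>" by (simp add: le_less_trans)
  then have m: "m = ennreal ((W2 \<mu> \<nu>)\<^sup>2)" unfolding W2_square m_def[symmetric] by simp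
  also have "\<dots> < ennreal ((W2 \<mu> \<nu>)\<^sup>2 + e)" using assms(3)
    by (intro ennreal_lessI) (auto simp: add_nonneg_pos)
  finally obtain \<gamma> where \<gamma>: "\<gamma> \<in> couplings \<mu> \<nu>"
    "(\<integral>\<^sup>+ z. ennreal ((norm (fst z - snd z))\<^sup>2) \<partial>\<gamma>) < ennreal ((W2 \<mu> \<nu>)\<^sup>2 + e)"
    unfolding m_def INF_less_iff by blast
  then show ?thesis using that[OF \<gamma>(1)] nn[OF \<gamma>(1)] by (simp add: ennreal_less_iff)
qed

text \<open>Integrate \<open>|x|\<^sup>2 \<le> 2 * (|x - y|\<^sup>2 + |y|\<^sup>2)\<close> against a
  nearly optimal coupling. It turns a bound on the distance to a fixed measure into a bound on
  second moments.\<close>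

lemma second_moment_le:
  assumes "\<mu> \<in> P2" "\<nu> \<in> P2"
  shows "(\<integral>x. (norm x)\<^sup>2 \<partial>\<mu>) \<le> 2 * ((W2 \<mu> \<nu>)\<^sup>2 + (\<integral>x. (norm x)\<^sup>2 \<partial>\<nu>))"
proof (rule field_le_epsilon)
  fix e :: real assume "0 < e"
  then obtain \<gamma> where \<gamma>: "\<gamma> \<in> couplings \<mu> \<nu>" "(\<integral>z. (norm (fst z - snd z))\<^sup>2 \<partial>\<gamma>) < (W2 \<mu> \<nu>)\<^sup>2 + e / 2"
    using W2_near_optimal[OF assms, of "e / 2"] by auto
  note [measurable_cong] = couplingsD(2)[OF \<gamma>(1)]
  have m: "fst \<in> borel_measurable \<gamma>" "snd \<in> borel_measurable \<gamma>" by measurable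
  note fst = integral_distr_P2[OF assms(1) m(1) couplingsD(3)[OF \<gamma>(1)]]
    and snd = integral_distr_P2[OF assms(2) m(2) couplingsD(4)[OF \<gamma>(1)]]
  note i = coupling_integrable[OF assms \<gamma>(1)]
  have "(norm x)\<^sup>2 \<le> 2 * ((norm (x - y))\<^sup>2 + (norm y)\<^sup>2)" for x y :: 'a
    using norm_diff_square_le[of "x - y" "- y"] by simp
  then have "(\<integral>z. (norm (fst z))\<^sup>2 \<partial>\<gamma>) \<le> (\<integral>z. 2 * ((norm (fst z - snd z))\<^sup>2 + (norm (snd z))\<^sup>2) \<partial>\<gamma>)"
    using fst snd i by (intro integral_mono) auto
  also have "\<dots> = 2 * ((\<integral>z. (norm (fst z - snd z))\<^sup>2 \<partial>\<gamma>) + (\<integral>z. (norm (snd z))\<^sup>2 \<partial>\<gamma>))"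
    using snd i by simp
  finally show "(\<integral>x. (norm x)\<^sup>2 \<partial>\<mu>) \<le> 2 * ((W2 \<mu> \<nu>)\<^sup>2 + (\<integral>x. (norm x)\<^sup>2 \<partial>\<nu>)) + e"
    using \<gamma>(2) fst snd by simp
qed

section \<open>Symmetry of the distance, and equality of measures at distance zero\<close>

text \<open>A Chebyshev estimate: under a coupling, mass of \<open>F\<close> either lands in the
  closed neighbourhood \<open>G n\<close> or travels further than \<open>d\<close>, the radius of
  \<open>G n\<close>. A cost below \<open>e * d\<^sup>2\<close> leaves less than \<open>e\<close>
  for the latter. The sets \<open>G n\<close> decrease to \<open>F\<close> because \<open>F\<close>
  is closed.\<close>

lemma measure_le_closed:
  assumes "\<mu> \<in> P2" "\<nu> \<in> P2" "W2 \<mu> \<nu> = 0" "closed F"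
  shows "measure \<mu> F \<le> measure \<nu> F"
\<comment> \<open>By convention \<open>infdist\<close> to the empty set is 0, so \<open>G n\<close>
  would be the whole space; the empty set is treated separately.\<close>
proof (cases "F = {}")
  case False
  interpret \<mu>: prob_space \<mu> by (rule P2D[OF assms(1)])
  interpret \<nu>: prob_space \<nu> by (rule P2D[OF assms(2)])
  note [measurable_cong] = P2D(2)[OF assms(1)] P2D(2)[OF assms(2)]
  define G where "G n = {y. infdist y F \<le> 1 / real (Suc n)}" for n
  have G[measurable]: "G n \<in> sets borel" for n
    unfolding G_def by (intro borel_closed closed_Collect_le continuous_intros)
  have le: "measure \<mu> F \<le> measure \<nu> (G n)" for n
  proof (rule field_le_epsilon)
    fix e :: real assume "0 < e"
    define d where "d = 1 / real (Suc n)"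
    have d: "0 < d" by (simp add: d_def)
    obtain \<gamma> where \<gamma>: "\<gamma> \<in> couplings \<mu> \<nu>" "(\<integral>z. (norm (fst z - snd z))\<^sup>2 \<partial>\<gamma>) < e * d\<^sup>2"
      using W2_near_optimal[OF assms(1,2), of "e * d\<^sup>2"] assms(3) \<open>0 < e\<close> d by auto
    interpret \<gamma>: prob_space \<gamma> by (rule couplingsD[OF \<gamma>(1)])
    note [measurable_cong] = couplingsD(2)[OF \<gamma>(1)]
    have F[measurable]: "F \<in> sets borel" using assms(4) by simp
    have i: "integrable \<gamma> (\<lambda>z. indicator F (fst z) :: real)" "integrable \<gamma> (\<lambda>z. indicator (G n) (snd
      z) :: real)"
      by (auto intro!: \<gamma>.integrable_const_bound[where B=1] simp: indicator_def)
    have "indicator F x \<le> indicator (G n) y + (norm (x - y))\<^sup>2 / d\<^sup>2" for x y :: 'a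
    proof (cases "x \<in> F \<and> y \<notin> G n")
      case True
      then have "d < infdist y F" by (simp add: G_def d_def)
      also have "\<dots> \<le> norm (x - y)" using infdist_le[of x F y] True
        by (simp add: dist_norm norm_minus_commute)
      finally have "d\<^sup>2 \<le> (norm (x - y))\<^sup>2" using d by (intro power_mono) auto
      then show ?thesis using d True by (simp add: field_simps)
    qed (auto simp: indicator_def)
    then have "(\<integral>z. indicator F (fst z) \<partial>\<gamma>) \<le> (\<integral>z. indicator (G n) (snd z) + (norm (fst z - snd
      z))\<^sup>2 / d\<^sup>2 \<partial>\<gamma>)"
      using coupling_integrable[OF assms(1,2) \<gamma>(1)] i
      by (intro integral_mono Bochner_Integration.integrable_add) auto
    also have "\<dots> = (\<integral>z. indicator (G n) (snd z) \<partial>\<gamma>) + (\<integral>z. (norm (fst z - snd z))\<^sup>2 \<partial>\<gamma>) / d\<^sup>2"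
      using coupling_integrable[OF assms(1,2) \<gamma>(1)] i by simp
    also have "(\<integral>z. indicator F (fst z) \<partial>\<gamma>) = measure \<mu> F"
    proof -
      have "measure \<mu> F = (\<integral>x. indicator F x \<partial>distr \<gamma> borel fst)"
        unfolding couplingsD(3)[OF \<gamma>(1)] using P2D(2)[OF assms(1)] by simp
      then show ?thesis by (subst (asm) integral_distr) auto
    qed
    also have "(\<integral>z. indicator (G n) (snd z) \<partial>\<gamma>) = measure \<nu> (G n)"
    proof -
      have "measure \<nu> (G n) = (\<integral>x. indicator (G n) x \<partial>distr \<gamma> borel snd)"
        unfolding couplingsD(4)[OF \<gamma>(1)] using P2D(2)[OF assms(2)] by simp
      then show ?thesis by (subst (asm) integral_distr) auto
    qed
    also have "(\<integral>z. (norm (fst z - snd z))\<^sup>2 \<partial>\<gamma>) / d\<^sup>2 \<le> e"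
      using \<gamma>(2) d by (simp add: field_simps)
    finally show "measure \<mu> F \<le> measure \<nu> (G n) + e" by simp
  qed
  have "(\<lambda>n. measure \<nu> (G n)) \<longlonglongrightarrow> measure \<nu> (\<Inter>n. G n)"
  proof (rule \<nu>.finite_Lim_measure_decseq)
    show "decseq G"
      unfolding decseq_def G_def by (auto elim!: order_trans simp: frac_le)
  qed (simp add: P2D(2)[OF assms(2)] image_subset_iff)
  moreover have "(\<Inter>n. G n) = F"
  proof
    show "(\<Inter>n. G n) \<subseteq> F"
    proof
      fix y assume "y \<in> (\<Inter>n. G n)"
      then have "\<And>n. infdist y F \<le> 1 / real (Suc n)" by (auto simp: G_def)
      then have "infdist y F \<le> 0"
        using LIMSEQ_le_const[OF LIMSEQ_Suc[OF lim_1_over_n]] by blast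
      then have "infdist y F = 0" using infdist_nonneg[of y F] by simp
      then show "y \<in> F" using in_closed_iff_infdist_zero[OF assms(4) False] by simp
    qed
    show "F \<subseteq> (\<Inter>n. G n)"
      by (simp add: G_def subset_iff)
  qed
  ultimately show ?thesis using LIMSEQ_le_const le by metis
qed simp

lemma W2_commute_le:
  assumes "\<mu> \<in> P2" "\<nu> \<in> P2"
  shows "W2 \<mu> \<nu> \<le> W2 \<nu> \<mu>"
proof -
  have "(W2 \<mu> \<nu>)\<^sup>2 \<le> (W2 \<nu> \<mu>)\<^sup>2"
  proof (rule field_le_epsilon)
    fix e :: real assume "0 < e"
    then obtain \<gamma> where \<gamma>: "\<gamma> \<in> couplings \<nu> \<mu>" "(\<integral>z. (norm (fst z - snd z))\<^sup>2 \<partial>\<gamma>) < (W2 \<nu> \<mu>)\<^sup>2 + e"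
      using W2_near_optimal[OF assms(2,1)] by metis
    note [measurable_cong] = couplingsD(2)[OF \<gamma>(1)]
    have "(W2 \<mu> \<nu>)\<^sup>2 \<le> (\<integral>z. (norm (snd z - fst z))\<^sup>2 \<partial>\<gamma>)"
      by (intro W2_square_le_distr[OF assms couplingsD(1)[OF \<gamma>(1)]] couplingsD[OF \<gamma>(1)]) measurable
    then show "(W2 \<mu> \<nu>)\<^sup>2 \<le> (W2 \<nu> \<mu>)\<^sup>2 + e" using \<gamma>(2) by (simp add: norm_minus_commute)
  qed
  then show ?thesis by (rule power2_le_imp_le) (rule W2_nonneg)
qed

lemma W2_commute: "\<mu> \<in> P2 \<Longrightarrow> \<nu> \<in> P2 \<Longrightarrow> W2 \<mu> \<nu> = W2 \<nu> \<mu>"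
  using W2_commute_le by (metis order_antisym)

text \<open>Symmetry of \<open>W2\<close> gives both inequalities on closed sets, which form an
  intersection-stable generator of the Borel sets.\<close>

lemma W2_eq_0_imp_eq:
  assumes "\<mu> \<in> P2" "\<nu> \<in> P2" "W2 \<mu> \<nu> = 0"
  shows "\<mu> = \<nu>"
proof (rule measure_eqI_generator_eq)
  interpret \<mu>: prob_space \<mu> by (rule P2D[OF assms(1)])
  interpret \<nu>: prob_space \<nu> by (rule P2D[OF assms(2)])
  show "Int_stable (Collect closed)" by (auto simp: Int_stable_def)
  show "Collect closed \<subseteq> Pow UNIV" by simp
  show "sets \<mu> = sigma_sets UNIV (Collect closed)" "sets \<nu> = sigma_sets UNIV (Collect closed)"
    using P2D(2)[OF assms(1)] P2D(2)[OF assms(2)] by (simp_all add: borel_eq_closed)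
  show "emeasure \<mu> F = emeasure \<nu> F" if "F \<in> Collect closed" for F
    using measure_le_closed[OF assms, of F] measure_le_closed[OF assms(2,1), of F] that assms
    by (simp add: \<mu>.emeasure_eq_measure \<nu>.emeasure_eq_measure W2_commute)
  show "range (\<lambda>i::nat. UNIV) \<subseteq> Collect closed" "(\<Union>i::nat. UNIV) = UNIV" by auto
  show "emeasure \<mu> UNIV \<noteq> \<infinity>" for i :: nat by simp
qed

section \<open>The perturbed Pythagorean inequality\<close>

lemma inner_square_le:
  fixes x d :: "'a::real_inner"
  assumes "norm d \<le> b"
  shows "(x \<bullet> d)\<^sup>2 \<le> b\<^sup>2 * (norm x)\<^sup>2"
proof -
  have "\<bar>x \<bullet> d\<bar> \<le> norm x * norm d" by (rule Cauchy_Schwarz_ineq2)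
  also have "\<dots> \<le> norm x * b" using assms by (intro mult_left_mono) auto
  finally have "\<bar>x \<bullet> d\<bar>\<^sup>2 \<le> (norm x * b)\<^sup>2" by (intro power_mono) auto
  then show ?thesis by (simp add: power_mult_distrib mult.commute)
qed

text \<open>This is for points without a common block: the constant \<open>j\<close> is later
  multiplied by the vanishing mass of the rest, and the square is absorbed by second moments divided
  by \<open>j\<close>.\<close>

lemma abs_le_add_square_div:
  fixes t j :: real assumes "0 < j"
  shows "\<bar>t\<bar> \<le> j + t\<^sup>2 / j"
proof (cases "\<bar>t\<bar> \<le> j")
  case False
  then have "j * \<bar>t\<bar> \<le> \<bar>t\<bar> * \<bar>t\<bar>" by (intro mult_right_mono) auto
  then have "\<bar>t\<bar> \<le> t\<^sup>2 / j"
    using assms by (simp add: field_simps power2_eq_square)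
  then show ?thesis using assms by simp
qed (use assms in \<open>simp add: add_increasing2\<close>)

lemma young_mult_le:
  fixes a b \<eta> :: real assumes "0 < \<eta>"
  shows "2 * (a * b) \<le> \<eta> * a\<^sup>2 + b\<^sup>2 / \<eta>"
proof -
  have "0 \<le> (\<eta> * a - b)\<^sup>2 / \<eta>" using assms by simp
  also have "\<dots> = \<eta> * a\<^sup>2 + b\<^sup>2 / \<eta> - 2 * (a * b)"
    using assms by (simp add: field_simps power2_eq_square)
  finally show ?thesis by simp
qed

text \<open>Write \<open>z - y = (z - p) - (y - q) + p - q\<close>. Young's inequality handles the
  first two differences; \<open>u \<bullet> p\<close> and \<open>u \<bullet> q\<close> are each
  bounded by the whole sum over \<open>D\<close>, which accounts for the factor 4.\<close>

lemma inner_approx_le: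
  fixes u z y :: "'a::real_inner"
  assumes "finite D" "p \<in> D" "q \<in> D" "0 < \<eta>"
  shows "2 * (u \<bullet> (z - y)) \<le> 2 * \<eta> * (norm u)\<^sup>2 + ((norm (z - p))\<^sup>2 + (norm (y - q))\<^sup>2) / \<eta> + 4 *
    (\<Sum>d\<in>D. \<bar>u \<bullet> d\<bar>)"
proof -
  have "u \<bullet> (z - y) = u \<bullet> (z - p) - u \<bullet> (y - q) + u \<bullet> p - u \<bullet> q"
    by (simp add: inner_diff_right)
  moreover have "\<bar>u \<bullet> p\<bar> \<le> (\<Sum>d\<in>D. \<bar>u \<bullet> d\<bar>)" "\<bar>u \<bullet> q\<bar> \<le> (\<Sum>d\<in>D. \<bar>u \<bullet> d\<bar>)"
    using assms by (auto intro!: member_le_sum[where f="\<lambda>d. \<bar>u \<bullet> d\<bar>"])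
  moreover have "2 * \<bar>u \<bullet> v\<bar> \<le> \<eta> * (norm u)\<^sup>2 + (norm v)\<^sup>2 / \<eta>" for v
    using Cauchy_Schwarz_ineq2[of u v] young_mult_le[OF assms(4), of "norm u" "norm v"] by linarith
  from this[of "z - p"] this[of "y - q"]
  have "2 * \<bar>u \<bullet> (z - p)\<bar> + 2 * \<bar>u \<bullet> (y - q)\<bar> \<le> 2 * \<eta> * (norm u)\<^sup>2 + ((norm (z - p))\<^sup>2 + (norm (y -
    q))\<^sup>2) / \<eta>"
    by (simp add: add_divide_distrib)
  ultimately show ?thesis by linarith
qed

context partitioned_pair
begin

text \<open>In the application \<open>\<mu>\<close>, \<open>\<nu>\<close>, \<open>\<rho>\<close> are
  the n-th measure, the limit and the competitor. Under \<open>glue \<gamma>\<close> the coordinates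
  \<open>X\<close>, \<open>Y\<close>, \<open>Z\<close> have laws \<open>\<mu>\<close>,
  \<open>\<rho>\<close>, \<open>\<nu>\<close>. The error terms come, in order, from Young's
  inequality, from replacing \<open>Z\<close> and \<open>Y\<close> by the finitely valued
  \<open>s\<close> and \<open>t\<close>, from the width of the blocks, and from the mass outside the
  blocks.\<close>

lemma W2_split_le:
  fixes D :: "'a set"
  assumes P2: "\<mu> \<in> P2" "\<nu> \<in> P2" "\<rho> \<in> P2" and \<gamma>: "\<gamma> \<in> couplings \<mu> \<rho>"
    and D: "finite D" "\<And>d. d \<in> D \<Longrightarrow> norm d \<le> b"
    and j: "0 < (j::real)"
    and fine: "\<And>k x x' d. \<lbrakk>k \<in> I; \<phi> k x \<noteq> 0; \<phi> k x' \<noteq> 0; d \<in> D\<rbrakk>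
      \<Longrightarrow> \<bar>(x - x') \<bullet> d\<bar> \<le> 2 / j + ((x \<bullet> d)\<^sup>2 + (x' \<bullet> d)\<^sup>2) / j"
    and s[measurable]: "s \<in> borel_measurable borel" "t \<in> borel_measurable borel"
    and sD: "\<And>x. s x \<in> D" "\<And>x. t x \<in> D"
    and es: "integrable \<nu> (\<lambda>x. (norm (x - s x))\<^sup>2)" "(\<integral>x. (norm (x - s x))\<^sup>2 \<partial>\<nu>) \<le> e"
    and et: "integrable \<rho> (\<lambda>x. (norm (x - t x))\<^sup>2)" "(\<integral>x. (norm (x - t x))\<^sup>2 \<partial>\<rho>) \<le> e"
    and C: "(\<integral>x. (norm x)\<^sup>2 \<partial>\<mu>) + (\<integral>x. (norm x)\<^sup>2 \<partial>\<nu>) \<le> C"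
    and \<eta>: "0 < \<eta>"
  shows "(W2 \<mu> \<nu>)\<^sup>2 + (W2 \<rho> \<nu>)\<^sup>2 \<le> (\<integral>z. (norm (fst z - snd z))\<^sup>2 \<partial>\<gamma>) + 4 * \<eta> * C + 2 * e / \<eta>
     + 4 * (real (card D) * (2 / j + 3 * b\<^sup>2 * C / j) + real (card D) * j * (1 - block_overlap I \<phi> \<mu> \<nu>))"
proof -
  let ?\<Theta> = "glue \<gamma>" and ?N = "real (card D)"
  interpret \<Theta>: prob_space ?\<Theta> by (rule prob_space_glue[OF \<gamma>])
  define X Y Z where "X w = fst (fst w)" and "Y w = snd (fst w)"
    and "Z w = snd w" for w :: "('a \<times> 'a) \<times> 'a"
  note [measurable_cong] = sets_glue[OF couplingsD(2)[OF \<gamma>]] couplingsD(2)[OF \<gamma>] P2D(2)[OF P2(3)]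
  have [measurable]: "X \<in> borel_measurable ?\<Theta>" "Y \<in> borel_measurable ?\<Theta>" "Z \<in> borel_measurable ?\<Theta>"
    unfolding X_def Y_def Z_def by measurable
  have X: "distr ?\<Theta> borel X = \<mu>"
    using distr_distr[of fst borel borel fst ?\<Theta>] couplingsD(3)[OF \<gamma>]
    by (simp add: distr_glue[OF \<gamma>] comp_def X_def[abs_def])
  have Y: "distr ?\<Theta> borel Y = \<rho>"
    using distr_distr[of snd borel borel fst ?\<Theta>] couplingsD(4)[OF \<gamma>]
    by (simp add: distr_glue[OF \<gamma>] comp_def Y_def[abs_def])
  have Z: "distr ?\<Theta> borel Z = \<nu>"
    using distr_glue(2)[OF \<gamma>] by (simp add: Z_def[abs_def])
  note iX = integral_distr_P2[OF P2(1) _ X, simplified]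
    and iY = integral_distr_P2[OF P2(3) _ Y, simplified]
    and iZ = integral_distr_P2[OF P2(2) _ Z, simplified]
  define T where "T x x' = (\<Sum>d\<in>D. \<bar>(x - x') \<bullet> d\<bar>)" for x x' :: 'a
  \<comment> \<open>The constant 3 covers both uses: the estimate within a block needs the factor 1,
    and \<open>norm_diff_square_le\<close> on the rest needs the factor 2.\<close>
  define U where "U x x' = ?N * (2 / j + 3 * b\<^sup>2 * ((norm x)\<^sup>2 + (norm x')\<^sup>2) / j)" for x x' :: 'a
  have U_nonneg: "0 \<le> U x x'" for x x' using j by (auto simp: U_def)
  have T_nonneg: "0 \<le> T x x'" for x x' by (auto simp: T_def intro: sum_nonneg)
  have b: "0 \<le> b\<^sup>2 * P / j" if "0 \<le> P" for P using that j by simp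
  have T_diag: "T x x' \<le> U x x'" if k: "k \<in> I" "\<phi> k x \<noteq> 0" "\<phi> k x' \<noteq> 0" for k x x'
  proof -
    have "T x x' \<le> (\<Sum>d\<in>D. 2 / j + 3 * b\<^sup>2 * ((norm x)\<^sup>2 + (norm x')\<^sup>2) / j)"
      unfolding T_def
    proof (rule sum_mono)
      fix d assume d: "d \<in> D"
      have "((x \<bullet> d)\<^sup>2 + (x' \<bullet> d)\<^sup>2) / j \<le> (b\<^sup>2 * ((norm x)\<^sup>2 + (norm x')\<^sup>2)) / j"
        using inner_square_le[OF D(2)[OF d], of x] inner_square_le[OF D(2)[OF d], of x'] j
        by (intro divide_right_mono) (auto simp: distrib_left)
      then show "\<bar>(x - x') \<bullet> d\<bar> \<le> 2 / j + 3 * b\<^sup>2 * ((norm x)\<^sup>2 + (norm x')\<^sup>2) / j"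
        using fine[OF k d] b[of "(norm x)\<^sup>2 + (norm x')\<^sup>2"] by simp
    qed
    then show ?thesis by (simp add: U_def)
  qed
  have T_rest: "T x x' \<le> U x x' + ?N * j" for x x'
  proof -
    have "T x x' \<le> (\<Sum>d\<in>D. (2 / j + 3 * b\<^sup>2 * ((norm x)\<^sup>2 + (norm x')\<^sup>2) / j) + j)"
      unfolding T_def
    proof (rule sum_mono)
      fix d assume d: "d \<in> D"
      have "b\<^sup>2 * (norm (x - x'))\<^sup>2 \<le> b\<^sup>2 * (2 * ((norm x)\<^sup>2 + (norm x')\<^sup>2))"
        by (intro mult_left_mono norm_diff_square_le) simp
      then have "((x - x') \<bullet> d)\<^sup>2 / j \<le> (b\<^sup>2 * (2 * ((norm x)\<^sup>2 + (norm x')\<^sup>2))) / j"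
        using inner_square_le[OF D(2)[OF d], of "x - x'"] j by (intro divide_right_mono) auto
      moreover have "(b\<^sup>2 * (2 * ((norm x)\<^sup>2 + (norm x')\<^sup>2))) / j \<le> 3 * b\<^sup>2 * ((norm x)\<^sup>2 + (norm
        x')\<^sup>2) / j"
        using j by (intro divide_right_mono) (auto simp: algebra_simps)
      moreover have "0 \<le> 2 / j" using j by simp
      ultimately show "\<bar>(x - x') \<bullet> d\<bar> \<le> 2 / j + 3 * b\<^sup>2 * ((norm x)\<^sup>2 + (norm x')\<^sup>2) / j + j"
        using abs_le_add_square_div[OF j, of "(x - x') \<bullet> d"] by linarith
    qed
    then show ?thesis by (simp add: U_def distrib_left)
  qed
  have iXZ: "integrable ?\<Theta> (\<lambda>w. (norm (X w - Z w))\<^sup>2)"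
    and iZY: "integrable ?\<Theta> (\<lambda>w. (norm (Z w - Y w))\<^sup>2)"
    and iXY: "integrable ?\<Theta> (\<lambda>w. (norm (X w - Y w))\<^sup>2)"
    using iX iY iZ by (auto intro!: integrable_norm_diff_square)
  have iU: "integrable ?\<Theta> (\<lambda>w. U (X w) (Z w))"
    unfolding U_def using iX iZ by auto
  have [measurable]: "(\<lambda>z. T (fst z) (snd z)) \<in> borel_measurable borel"
    "(\<lambda>z. U (fst z) (snd z)) \<in> borel_measurable borel"
    unfolding T_def U_def by measurable
  have iT: "integrable ?\<Theta> (\<lambda>w. T (X w) (Z w))"
  proof (rule Bochner_Integration.integrable_bound)
    show "integrable ?\<Theta> (\<lambda>w. U (X w) (Z w) + ?N * j)" using iU by simp
    show "(\<lambda>w. T (X w) (Z w)) \<in> borel_measurable ?\<Theta>" unfolding T_def by measurable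
    show "AE w in ?\<Theta>. norm (T (X w) (Z w)) \<le> norm (U (X w) (Z w) + ?N * j)"
      using T_rest T_nonneg by (auto intro!: AE_I2 order_trans[OF _ abs_ge_self])
  qed
  have intT: "(\<integral>w. T (X w) (Z w) \<partial>?\<Theta>)
      \<le> ?N * (2 / j + 3 * b\<^sup>2 * C / j) + ?N * j * (1 - block_overlap I \<phi> \<mu> \<nu>)"
  proof -
    have "(\<integral>\<^sup>+w. ennreal (T (fst (fst w)) (snd w)) \<partial>?\<Theta>) \<le>
        (\<integral>\<^sup>+w. ennreal (U (fst (fst w)) (snd w)) \<partial>?\<Theta>) + ennreal (?N * j) * ennreal (1 -
          block_overlap I \<phi> \<mu> \<nu>)"
    proof (rule nn_integral_glue_le[OF \<gamma>])
      show "ennreal (T x x') \<le> ennreal (U x x') + ennreal (?N * j)" for x x'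
        using T_rest[of x x'] U_nonneg[of x x'] j
        by (subst ennreal_plus[symmetric]) (auto intro: ennreal_leI simp del: ennreal_plus)
    qed (auto intro: ennreal_leI T_diag)
    also have "(\<integral>\<^sup>+w. ennreal (U (fst (fst w)) (snd w)) \<partial>?\<Theta>) = ennreal (\<integral>w. U (X w) (Z w) \<partial>?\<Theta>)"
      using iU U_nonneg by (subst nn_integral_eq_integral[symmetric]) (auto simp: X_def Z_def)
    also have "(\<integral>\<^sup>+w. ennreal (T (fst (fst w)) (snd w)) \<partial>?\<Theta>) = ennreal (\<integral>w. T (X w) (Z w) \<partial>?\<Theta>)"
      using iT T_nonneg by (subst nn_integral_eq_integral[symmetric]) (auto simp: X_def Z_def)
    also have "ennreal (\<integral>w. U (X w) (Z w) \<partial>?\<Theta>) + ennreal (?N * j) * ennreal (1 - block_overlap I \<phi> \<mu> \<nu>) =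
        ennreal ((\<integral>w. U (X w) (Z w) \<partial>?\<Theta>) + ?N * j * (1 - block_overlap I \<phi> \<mu> \<nu>))"
      using j overlap_le_1 U_nonneg
        by (simp add: ennreal_mult[symmetric] ennreal_plus[symmetric] del: ennreal_plus)
    finally have "(\<integral>w. T (X w) (Z w) \<partial>?\<Theta>) \<le> (\<integral>w. U (X w) (Z w) \<partial>?\<Theta>) + ?N * j * (1 - block_overlap I
      \<phi> \<mu> \<nu>)"
      using j overlap_le_1 U_nonneg by (subst (asm) ennreal_le_iff) auto
    also have "(\<integral>w. U (X w) (Z w) \<partial>?\<Theta>) =
        ?N * (2 / j + 3 * b\<^sup>2 * ((\<integral>x. (norm x)\<^sup>2 \<partial>\<mu>) + (\<integral>x. (norm x)\<^sup>2 \<partial>\<nu>)) / j)"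
      unfolding U_def using iX iZ by (simp add: \<Theta>.prob_space)
    also have "\<dots> \<le> ?N * (2 / j + 3 * b\<^sup>2 * C / j)"
      using C j by (intro mult_left_mono add_left_mono divide_right_mono) auto
    finally show ?thesis by simp
  qed
  have es': "integrable ?\<Theta> (\<lambda>w. (norm (Z w - s (Z w)))\<^sup>2)" "(\<integral>w. (norm (Z w - s (Z w)))\<^sup>2 \<partial>?\<Theta>) \<le> e"
    using integrable_distr_eq[of Z ?\<Theta> borel "\<lambda>x. (norm (x - s x))\<^sup>2"]
      integral_distr[of Z ?\<Theta> borel "\<lambda>x. (norm (x - s x))\<^sup>2"] es unfolding Z by simp_all
  have et': "integrable ?\<Theta> (\<lambda>w. (norm (Y w - t (Y w)))\<^sup>2)" "(\<integral>w. (norm (Y w - t (Y w)))\<^sup>2 \<partial>?\<Theta>) \<le> e"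
    using integrable_distr_eq[of Y ?\<Theta> borel "\<lambda>x. (norm (x - t x))\<^sup>2"]
      integral_distr[of Y ?\<Theta> borel "\<lambda>x. (norm (x - t x))\<^sup>2"] et unfolding Y by simp_all
  have "(W2 \<mu> \<nu>)\<^sup>2 + (W2 \<rho> \<nu>)\<^sup>2 \<le> (\<integral>w. (norm (X w - Z w))\<^sup>2 \<partial>?\<Theta>) + (\<integral>w. (norm (Y w - Z w))\<^sup>2 \<partial>?\<Theta>)"
    using X Y Z by (intro add_mono W2_square_le_distr P2 \<Theta>.prob_space_axioms) auto
  also have "\<dots> = (\<integral>w. (norm (X w - Z w))\<^sup>2 + (norm (Z w - Y w))\<^sup>2 \<partial>?\<Theta>)"
    using iXZ iZY by (simp add: norm_minus_commute)
  also have "\<dots> \<le> (\<integral>w. (norm (X w - Y w))\<^sup>2 + (4 * \<eta> * ((norm (X w))\<^sup>2 + (norm (Z w))\<^sup>2)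
      + ((norm (Z w - s (Z w)))\<^sup>2 + (norm (Y w - t (Y w)))\<^sup>2) / \<eta> + 4 * T (X w) (Z w)) \<partial>?\<Theta>)"
  proof (rule integral_mono)
    fix w
    have "(norm (X w - Z w))\<^sup>2 + (norm (Z w - Y w))\<^sup>2 = (norm (X w - Y w))\<^sup>2 + 2 * ((Z w - X w) \<bullet> (Z
      w - Y w))"
      by (simp add: power2_norm_eq_inner inner_diff inner_commute)
    \<comment> \<open>The approximants are \<open>s (Z w)\<close> and \<open>t (Y w)\<close>. Both
      lie in the fixed finite set \<open>D\<close>, so \<open>Z w - X w\<close> has to be small only
      in the directions of \<open>D\<close>.\<close>
    also have "2 * ((Z w - X w) \<bullet> (Z w - Y w)) \<le> 2 * \<eta> * (norm (Z w - X w))\<^sup>2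
        + ((norm (Z w - s (Z w)))\<^sup>2 + (norm (Y w - t (Y w)))\<^sup>2) / \<eta> + 4 * (\<Sum>d\<in>D. \<bar>(Z w - X w) \<bullet> d\<bar>)"
      using D sD \<eta> by (intro inner_approx_le) auto
    also have "(\<Sum>d\<in>D. \<bar>(Z w - X w) \<bullet> d\<bar>) = T (X w) (Z w)"
      unfolding T_def by (simp add: inner_diff_left abs_minus_commute)
    also have "2 * \<eta> * (norm (Z w - X w))\<^sup>2 \<le> 2 * \<eta> * (2 * ((norm (Z w))\<^sup>2 + (norm (X w))\<^sup>2))"
      using \<eta> by (intro mult_left_mono norm_diff_square_le) auto
    finally show "(norm (X w - Z w))\<^sup>2 + (norm (Z w - Y w))\<^sup>2 \<le> (norm (X w - Y w))\<^sup>2 + (4 * \<eta> *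
      ((norm (X w))\<^sup>2 + (norm (Z w))\<^sup>2)
      + ((norm (Z w - s (Z w)))\<^sup>2 + (norm (Y w - t (Y w)))\<^sup>2) / \<eta> + 4 * T (X w) (Z w))"
      by (simp add: algebra_simps)
  qed (use iX iY iZ iXZ iZY iXY es' et' iT in auto)
  also have "\<dots> = (\<integral>w. (norm (X w - Y w))\<^sup>2 \<partial>?\<Theta>) + (4 * \<eta> * ((\<integral>x. (norm x)\<^sup>2 \<partial>\<mu>) + (\<integral>x. (norm x)\<^sup>2 \<partial>\<nu>))
      + ((\<integral>w. (norm (Z w - s (Z w)))\<^sup>2 \<partial>?\<Theta>) + (\<integral>w. (norm (Y w - t (Y w)))\<^sup>2 \<partial>?\<Theta>)) / \<eta>
      + 4 * (\<integral>w. T (X w) (Z w) \<partial>?\<Theta>))"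
    using iX iZ iXY es'(1) et'(1) iT by simp
  also have "(\<integral>w. (norm (X w - Y w))\<^sup>2 \<partial>?\<Theta>) = (\<integral>z. (norm (fst z - snd z))\<^sup>2 \<partial>\<gamma>)"
  proof -
    have "(\<integral>z. (norm (fst z - snd z))\<^sup>2 \<partial>\<gamma>) = (\<integral>z. (norm (fst z - snd z))\<^sup>2 \<partial>distr ?\<Theta> borel fst)"
      by (simp add: distr_glue[OF \<gamma>])
    then show ?thesis by (simp add: integral_distr X_def Y_def)
  qed
  also have "4 * \<eta> * ((\<integral>x. (norm x)\<^sup>2 \<partial>\<mu>) + (\<integral>x. (norm x)\<^sup>2 \<partial>\<nu>)) \<le> 4 * \<eta> * C"
    using C \<eta> by (intro mult_left_mono) auto
  also have "((\<integral>w. (norm (Z w - s (Z w)))\<^sup>2 \<partial>?\<Theta>) + (\<integral>w. (norm (Y w - t (Y w)))\<^sup>2 \<partial>?\<Theta>)) / \<eta> \<le> (2 * e) / \<eta>"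
    using es'(2) et'(2) \<eta> by (intro divide_right_mono) auto
  finally show ?thesis using intT by simp
qed

end

section \<open>Second moments under weak convergence\<close>

text \<open>Simple functions converge pointwise to the identity with norm at most
  \<open>2 * norm x\<close>, so the squared error is dominated by
  \<open>9 * (norm x)\<^sup>2\<close>. The finite range supplies the directions in which the
  partition must be fine.\<close>

lemma P2_finite_range_approx:
  fixes \<nu> :: "'a::{real_inner, complete_space, second_countable_topology} measure"
  assumes "\<nu> \<in> P2" "0 < e"
  obtains s where "s \<in> borel_measurable borel" "finite (range s)"
    "integrable \<nu> (\<lambda>x. (norm (x - s x))\<^sup>2)" "(\<integral>x. (norm (x - s x))\<^sup>2 \<partial>\<nu>) \<le> e"
proof -
  note sets[measurable_cong] = P2D(2)[OF assms(1)]
  obtain F :: "nat \<Rightarrow> 'a \<Rightarrow> 'a" where F: "\<And>i. simple_function borel (F i)"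
    "\<And>x. (\<lambda>i. F i x) \<longlonglongrightarrow> x" "\<And>i x. norm (F i x) \<le> 2 * norm x"
    using borel_measurable_implies_sequence_metric[of "\<lambda>x. x" borel "0::'a"] by auto
  have [measurable]: "F i \<in> borel_measurable borel" for i
    using F(1) by (rule borel_measurable_simple_function)
  have bound: "(norm (x - F i x))\<^sup>2 \<le> 9 * (norm x)\<^sup>2" for x i
  proof -
    have "norm (x - F i x) \<le> 3 * norm x"
      using norm_triangle_ineq4[of x "F i x"] F(3)[of i x] by simp
    then have "(norm (x - F i x))\<^sup>2 \<le> (3 * norm x)\<^sup>2" by (intro power_mono) auto
    then show ?thesis by (simp add: power_mult_distrib)
  qed
  have "(\<lambda>i. \<integral>x. (norm (x - F i x))\<^sup>2 \<partial>\<nu>) \<longlonglongrightarrow> (\<integral>x. 0 \<partial>\<nu>)"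
  proof (rule integral_dominated_convergence)
    show "integrable \<nu> (\<lambda>x. 9 * (norm x)\<^sup>2)" using P2D(3)[OF assms(1)] by simp
    have "(\<lambda>i. (norm (x - F i x))\<^sup>2) \<longlonglongrightarrow> (norm (x - x))\<^sup>2" for x
      by (intro tendsto_intros F)
    then show "AE x in \<nu>. (\<lambda>i. (norm (x - F i x))\<^sup>2) \<longlonglongrightarrow> 0" by simp
  qed (use bound in auto)
  then have "\<forall>\<^sub>F i in sequentially. (\<integral>x. (norm (x - F i x))\<^sup>2 \<partial>\<nu>) < e"
    using assms(2) by (intro order_tendstoD) auto
  then obtain i where i: "(\<integral>x. (norm (x - F i x))\<^sup>2 \<partial>\<nu>) < e"
    by (auto simp: eventually_sequentially)
  show ?thesis
  proof (rule that)
    show "finite (range (F i))" using simple_functionD(1)[OF F(1)[of i]] by simp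
    show "integrable \<nu> (\<lambda>x. (norm (x - F i x))\<^sup>2)"
      by (rule Bochner_Integration.integrable_bound[where f="\<lambda>x. 9 * (norm x)\<^sup>2"])
        (use P2D(3)[OF assms(1)] bound in auto)
  qed (use i in auto)
qed

text \<open>Each partition function is a bounded test function, so each minimum converges to its
  integral under \<open>\<mu>\<close>; these integrals sum to 1.\<close>

lemma block_overlap_tendsto_1:
  assumes "weak_partition I \<phi>" "\<mu> \<in> P2" "limitin P2w \<mu>s \<mu> sequentially"
  shows "(\<lambda>n. block_overlap I \<phi> (\<mu>s n) \<mu>) \<longlonglongrightarrow> 1"
proof -
  interpret \<mu>: prob_space \<mu> by (rule P2D[OF assms(2)])
  \<comment> \<open>Both measures are the limit, which gives access to the facts on the partition
    under \<open>\<mu>\<close>.\<close>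
  interpret partitioned_pair I \<phi> \<mu> \<mu>
    by (rule partitioned_pair.intro[OF assms(1) P2D(1,1)[OF assms(2)] P2D(2,2)[OF assms(2)]])
  have "\<phi> k \<in> test_functions" if "k \<in> I" for k
    using assms(1) that phi_nonneg[OF that] weak_partition_le_1[OF assms(1) that]
    by (intro test_functions_bounded[where B=1]) (auto simp: weak_partition_def)
  then have "(\<lambda>n. block_overlap I \<phi> (\<mu>s n) \<mu>) \<longlonglongrightarrow> (\<Sum>k\<in>I. min (\<integral>x. \<phi> k x \<partial>\<mu>) (\<integral>x. \<phi> k x \<partial>\<mu>))"
    unfolding block_overlap_def
    by (intro tendsto_sum tendsto_min tendsto_const limitin_P2w_imp_tendsto[OF assms(3)])
  also have "(\<Sum>k\<in>I. min (\<integral>x. \<phi> k x \<partial>\<mu>) (\<integral>x. \<phi> k x \<partial>\<mu>)) = (\<integral>x. (\<Sum>k\<in>I. \<phi> k x) \<partial>\<mu>)"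
    using phi_integrable by (subst Bochner_Integration.integral_sum) auto
  also have "\<dots> = 1" by (simp add: phi_sum \<mu>.prob_space)
  finally show ?thesis .
qed

section \<open>Second moments stay bounded along infinitely many indices\<close>

text \<open>A weakly continuous minorant of the squared norm, tested on finitely many normalised
  directions. The recursion starts at 0 and uses a binary maximum, so weak continuity follows by
  induction.\<close>

primrec max_inner_square :: "(nat \<Rightarrow> 'a::real_inner) \<Rightarrow> nat \<Rightarrow> 'a \<Rightarrow> real" where
  "max_inner_square e 0 x = 0"
| "max_inner_square e (Suc n) x = max (max_inner_square e n x) ((x \<bullet> sgn (e n))\<^sup>2)"

lemma max_inner_square_ge: "i < n \<Longrightarrow> (x \<bullet> sgn (e i))\<^sup>2 \<le> max_inner_square e n x"
  by (induction n) (auto simp: less_Suc_eq)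

lemma max_inner_square_nonneg: "0 \<le> max_inner_square e n x"
  by (induction n) (auto simp: le_max_iff_disj)

lemma max_inner_square_le: "max_inner_square e n x \<le> (norm x)\<^sup>2"
proof (induction n)
  case (Suc n)
  have "\<bar>x \<bullet> sgn (e n)\<bar> \<le> norm x * norm (sgn (e n))" by (rule Cauchy_Schwarz_ineq2)
  also have "\<dots> \<le> norm x" by (auto simp: norm_sgn)
  finally have "\<bar>x \<bullet> sgn (e n)\<bar>\<^sup>2 \<le> (norm x)\<^sup>2" by (intro power_mono) auto
  then show ?case using Suc by simp
qed simp

lemma seq_weakly_continuous_max_inner_square: "seq_weakly_continuous (max_inner_square e n)"
proof (induction n)
  case 0
  then show ?case by (simp add: seq_weakly_continuous_def)
next
  case (Suc n)
  have "seq_weakly_continuous (\<lambda>x. (x \<bullet> sgn (e n))\<^sup>2)"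
    by (intro seq_weakly_continuous_inner[where g="\<lambda>t. t\<^sup>2"] continuous_intros)
  then show ?case using seq_weakly_continuous_max[OF Suc] by simp
qed

text \<open>The maxima over the first \<open>n\<close> directions of a dense sequence, truncated at
  height \<open>n\<close>, converge pointwise to the squared norm and are dominated by it. Dominated
  convergence then brings their integrals above \<open>r\<close>.\<close>

lemma second_moment_approx_from_below:
  fixes \<mu> :: "'a::{real_inner, complete_space, second_countable_topology} measure"
  assumes "\<mu> \<in> P2" "r < (\<integral>x. (norm x)\<^sup>2 \<partial>\<mu>)"
  obtains f B where "seq_weakly_continuous f" "\<And>x. 0 \<le> f x" "\<And>x. f x \<le> (norm x)\<^sup>2"
    "\<And>x. f x \<le> B" "r < (\<integral>x. f x \<partial>\<mu>)"
proof -
  note sets[measurable_cong] = P2D(2)[OF assms(1)]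
  obtain D :: "'a set" where D: "countable D" "\<And>X. open X \<Longrightarrow> X \<noteq> {} \<Longrightarrow> \<exists>d\<in>D. d \<in> X"
    by (erule countable_dense_setE)
  then have ne: "D \<noteq> {}" using D(2)[of UNIV] by auto
  define e where "e = from_nat_into D"
  define f where "f n x = min (max_inner_square e n x) (real n)" for n x
  have swc: "seq_weakly_continuous (f n)" for n
    unfolding f_def by (intro seq_weakly_continuous_min seq_weakly_continuous_max_inner_square)
      (simp add: seq_weakly_continuous_def)
  have [measurable]: "f n \<in> borel_measurable borel" for n
    by (rule borel_measurable_seq_weakly_continuous[OF swc])
  have f: "0 \<le> f n x" "f n x \<le> (norm x)\<^sup>2" for n x
    using max_inner_square_nonneg[of e n x] max_inner_square_le[of e n x] by (auto simp: f_def)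
  have lim: "(\<lambda>n. f n x) \<longlonglongrightarrow> (norm x)\<^sup>2" for x
  proof (cases "x = 0")
    case True
    then have "f n x = 0" for n using f[of n 0] by simp
    then show ?thesis using True by simp
  next
    case False
    show ?thesis
    proof (rule order_tendstoI)
      fix a assume a: "a < (norm x)\<^sup>2"
      \<comment> \<open>Away from 0 normalisation is continuous, so a dense direction near
        \<open>x\<close> already captures more than \<open>a\<close> of the squared norm.\<close>
      have "isCont (\<lambda>y. (x \<bullet> sgn y)\<^sup>2) x"
        using False by (intro continuous_intros isCont_sgn) auto
      moreover have "(x \<bullet> sgn x)\<^sup>2 = (norm x)\<^sup>2"
        using False by (simp add: sgn_div_norm power2_norm_eq_inner[symmetric] power2_eq_square
          field_simps)
      ultimately have "\<forall>\<^sub>F y in at x. a < (x \<bullet> sgn y)\<^sup>2" "a < (x \<bullet> sgn x)\<^sup>2"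
        using a by (auto intro!: order_tendstoD simp: isCont_def)
      then have "\<forall>\<^sub>F y in nhds x. a < (x \<bullet> sgn y)\<^sup>2"
        by (simp add: eventually_nhds_conv_at)
      then obtain S where S: "open S" "x \<in> S" "\<And>y. y \<in> S \<Longrightarrow> a < (x \<bullet> sgn y)\<^sup>2"
        by (auto simp: eventually_nhds)
      then obtain d where d: "d \<in> D" "a < (x \<bullet> sgn d)\<^sup>2" using D(2)[of S] by auto
      then obtain i where i: "e i = d"
        using from_nat_into_surj[OF D(1)] by (auto simp: e_def)
      obtain N :: nat where N: "a < real N" using reals_Archimedean2 by blast
      \<comment> \<open>\<open>Suc i\<close> puts the chosen direction among the first
        \<open>n\<close>, and \<open>N\<close> keeps the truncation above \<open>a\<close>.\<close>
      have "a < f n x" if "n \<ge> max (Suc i) N" for n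
        using that d(2) N i max_inner_square_ge[of i n x e] by (auto simp: f_def)
      then show "\<forall>\<^sub>F n in sequentially. a < f n x"
        by (rule eventually_sequentiallyI)
    next
      fix a assume "(norm x)\<^sup>2 < a"
      then show "\<forall>\<^sub>F n in sequentially. f n x < a"
        using f(2)[of _ x] by (intro always_eventually allI) (rule le_less_trans)
    qed
  qed
  have "(\<lambda>n. \<integral>x. f n x \<partial>\<mu>) \<longlonglongrightarrow> (\<integral>x. (norm x)\<^sup>2 \<partial>\<mu>)"
    by (rule integral_dominated_convergence[where w="\<lambda>x. (norm x)\<^sup>2"])
      (use P2D(3)[OF assms(1)] f lim in auto)
  then have "\<forall>\<^sub>F n in sequentially. r < (\<integral>x. f n x \<partial>\<mu>)"
    using assms(2) by (rule order_tendstoD)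
  then obtain n where "r < (\<integral>x. f n x \<partial>\<mu>)" by (auto simp: eventually_sequentially)
  then show ?thesis using that[of "f n" "real n"] swc f by (auto simp: f_def)
qed

text \<open>Gliding hump: if second moments tended to infinity, some \<open>f k\<close> would have
  integral above \<open>4 ^ k\<close> under a measure \<open>\<mu>s (N k)\<close>. With weight
  \<open>(1 / 2) ^ k\<close> this single term pushes the integral of the test function
  \<open>\<zeta>\<close> above \<open>2 ^ k\<close>, whereas these integrals converge and so are
  bounded.\<close>

lemma second_moment_frequently_bounded:
  fixes \<mu>s :: "nat \<Rightarrow> 'a::{real_inner, complete_space, second_countable_topology} measure"
  assumes P2: "\<And>n. \<mu>s n \<in> P2" and lim: "limitin P2w \<mu>s \<mu> sequentially"
  obtains C where "\<exists>\<^sub>F n in sequentially. (\<integral>x. (norm x)\<^sup>2 \<partial>\<mu>s n) \<le> C"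
proof (rule ccontr)
  assume "\<not> thesis"
  then have large: "\<forall>\<^sub>F n in sequentially. C < (\<integral>x. (norm x)\<^sup>2 \<partial>\<mu>s n)" for C
    using that by (auto simp: frequently_def not_le)
  have "\<exists>n f B. seq_weakly_continuous f \<and> (\<forall>x. 0 \<le> f x) \<and> (\<forall>x. f x \<le> (norm x)\<^sup>2) \<and> (\<forall>x. f x \<le> B)
    \<and> 4 ^ k < (\<integral>x. f x \<partial>\<mu>s n)" for k :: nat
  proof -
    obtain n where "4 ^ k < (\<integral>x. (norm x)\<^sup>2 \<partial>\<mu>s n)"
      using large by (meson eventually_sequentially order_refl)
    then show ?thesis using second_moment_approx_from_below[OF P2] by metis
  qed
  then obtain N f B where f: "\<And>k. seq_weakly_continuous (f k)" "\<And>k x. 0 \<le> f k x"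
    "\<And>k x. f k x \<le> (norm x)\<^sup>2" "\<And>k x. f k x \<le> B k" "\<And>k::nat. 4 ^ k < (\<integral>x. f k x \<partial>\<mu>s (N k))"
    by metis
  define \<zeta> where "\<zeta> x = (\<Sum>k. (1 / 2) ^ k * f k x)" for x
  have "\<zeta> \<in> test_functions"
    unfolding \<zeta>_def using f by (intro test_functions_suminf[where B=B]) auto
  then have swc: "seq_weakly_continuous \<zeta>" and "(\<lambda>n. \<integral>x. \<zeta> x \<partial>\<mu>s n) \<longlonglongrightarrow> (\<integral>x. \<zeta> x \<partial>\<mu>)"
    using limitin_P2w_imp_tendsto[OF lim] by (auto simp: test_functions_def)
  then have "Bseq (\<lambda>n. \<integral>x. \<zeta> x \<partial>\<mu>s n)" by (blast intro: convergent_imp_Bseq convergentI)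
  then obtain K where K: "\<And>n. \<bar>\<integral>x. \<zeta> x \<partial>\<mu>s n\<bar> \<le> K" by (auto simp: Bseq_def)
  have summable: "summable (\<lambda>k. (1 / 2) ^ k * f k x)" for x
    by (rule summable_comparison_test'[where g="\<lambda>k. (1 / 2) ^ k * (norm x)\<^sup>2" and N=0])
      (use f in \<open>auto simp: abs_mult intro!: summable_mult2 mult_left_mono\<close>)
  have \<zeta>_ge: "(1 / 2) ^ k * f k x \<le> \<zeta> x" for k x
    using sum_le_suminf[OF summable, of "{k}"] f(2) by (simp add: \<zeta>_def)
  have \<zeta>_nonneg: "0 \<le> \<zeta> x" for x
    using \<zeta>_ge[of 0 x] f(2)[of 0 x] by simp
  \<comment> \<open>The quadratic bound makes \<open>\<zeta>\<close> integrable under each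
    \<open>\<mu>s n\<close>, so its integral is a true value and monotonicity applies.\<close>
  have \<zeta>_le: "\<zeta> x \<le> 2 * (norm x)\<^sup>2" for x
  proof -
    have "\<zeta> x \<le> (\<Sum>k. (1 / 2) ^ k * (norm x)\<^sup>2)"
      unfolding \<zeta>_def using f(3) summable by (intro suminf_le summable_mult2 mult_left_mono) auto
    also have "\<dots> = (\<Sum>k. (1 / 2) ^ k) * (norm x)\<^sup>2" by (intro suminf_mult2[symmetric]) auto
    also have "\<dots> = 2 * (norm x)\<^sup>2" by (subst suminf_geometric) auto
    finally show ?thesis .
  qed
  have "2 ^ k \<le> K" for k :: nat
  proof -
    note [measurable_cong] = P2D(2)[OF P2[of "N k"]]
    have [measurable]: "\<zeta> \<in> borel_measurable borel" "f k \<in> borel_measurable borel"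
      using swc f(1) by (auto intro: borel_measurable_seq_weakly_continuous)
    have i1: "integrable (\<mu>s (N k)) \<zeta>"
      by (rule Bochner_Integration.integrable_bound[where f="\<lambda>x. 2 * (norm x)\<^sup>2"])
        (use P2D(3)[OF P2] \<zeta>_le \<zeta>_nonneg in auto)
    have i2: "integrable (\<mu>s (N k)) (f k)"
      by (rule Bochner_Integration.integrable_bound[where f="\<lambda>x. (norm x)\<^sup>2"])
        (use P2D(3)[OF P2] f(2,3) in auto)
    have "2 ^ k = (1 / 2) ^ k * (4 ^ k :: real)" by (simp add: power_mult_distrib[symmetric])
    also have "\<dots> \<le> (1 / 2) ^ k * (\<integral>x. f k x \<partial>\<mu>s (N k))"
      using f(5)[of k] by (intro mult_left_mono) auto
    also have "\<dots> = (\<integral>x. (1 / 2) ^ k * f k x \<partial>\<mu>s (N k))" by simp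
    also have "\<dots> \<le> (\<integral>x. \<zeta> x \<partial>\<mu>s (N k))"
      using i1 i2 \<zeta>_ge by (intro integral_mono) auto
    also have "\<dots> \<le> K" using K[of "N k"] by simp
    finally show ?thesis .
  qed
  moreover obtain k :: nat where "K < 2 ^ k" using real_arch_pow[of 2 K] by auto
  ultimately show False by (meson not_le)
qed

section \<open>The Opial property\<close>

text \<open>The order of choices matters: \<open>\<eta>\<close> and \<open>e\<close>, then
  \<open>D\<close> and \<open>b\<close>, then \<open>j\<close> and the partition, and only then
  large \<open>n\<close>. The budget is \<open>\<epsilon> / 4\<close> each for
  \<open>\<eta>\<close>, \<open>e\<close> and the nearly optimal coupling, and
  \<open>\<epsilon> / 8\<close> each for the block width and the mass outside the blocks. The moment
  bound stands inside the implication because it may hold only for some \<open>n\<close>.\<close>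

lemma eventually_W2_split:
  fixes \<mu>s :: "nat \<Rightarrow> 'a::{real_inner, complete_space, second_countable_topology} measure"
  assumes P2: "\<And>n. \<mu>s n \<in> P2" "\<mu> \<in> P2" "\<nu> \<in> P2"
    and lim: "limitin P2w \<mu>s \<mu> sequentially" and \<epsilon>: "0 < \<epsilon>"
  shows "\<forall>\<^sub>F n in sequentially. (\<integral>x. (norm x)\<^sup>2 \<partial>\<mu>s n) \<le> C \<longrightarrow>
    (W2 (\<mu>s n) \<mu>)\<^sup>2 + (W2 \<nu> \<mu>)\<^sup>2 \<le> (W2 (\<mu>s n) \<nu>)\<^sup>2 + \<epsilon>"
proof -
  \<comment> \<open>The absolute value and the added 1 make \<open>C'\<close> positive for every
    real \<open>C\<close>, so that one can divide by it.\<close>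
  define C' where "C' = \<bar>C\<bar> + (\<integral>x. (norm x)\<^sup>2 \<partial>\<mu>) + 1"
  have C': "0 < C'" by (simp add: C'_def add_nonneg_pos)
  define \<eta> where "\<eta> = \<epsilon> / (16 * C')"
  define e where "e = \<epsilon> * \<eta> / 8"
  have \<eta>: "0 < \<eta>" using \<epsilon> C' by (simp add: \<eta>_def)
  have e: "0 < e" using \<epsilon> \<eta> by (simp add: e_def)
  have \<eta>_eq: "4 * \<eta> * C' = \<epsilon> / 4" using C' by (simp add: \<eta>_def)
  have e_eq: "2 * e / \<eta> = \<epsilon> / 4" using \<eta> by (simp add: e_def)
  obtain s where s: "s \<in> borel_measurable borel" "finite (range s)"
    "integrable \<mu> (\<lambda>x. (norm (x - s x))\<^sup>2)" "(\<integral>x. (norm (x - s x))\<^sup>2 \<partial>\<mu>) \<le> e"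
    using P2_finite_range_approx[OF P2(2) e] .
  obtain t where t: "t \<in> borel_measurable borel" "finite (range t)"
    "integrable \<nu> (\<lambda>x. (norm (x - t x))\<^sup>2)" "(\<integral>x. (norm (x - t x))\<^sup>2 \<partial>\<nu>) \<le> e"
    using P2_finite_range_approx[OF P2(3) e] .
  define D where "D = range s \<union> range t"
  have D: "finite D" using s t by (simp add: D_def)
  define b where "b = (\<Sum>d\<in>D. norm d)"
  have b: "norm d \<le> b" if "d \<in> D" for d
    unfolding b_def using that D by (intro member_le_sum) auto
  \<comment> \<open>The block-width error is exactly \<open>A / real j\<close>, so \<open>j\<close>
    can be chosen from \<open>A\<close> and \<open>\<epsilon>\<close>.\<close>
  define A where "A = 4 * (real (card D) * (2 + 3 * b\<^sup>2 * C'))"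
  obtain j :: nat where j: "8 * A / \<epsilon> < real j" using reals_Archimedean2 by blast
  have "0 \<le> A" using C' by (simp add: A_def)
  then have j0: "0 < real j" using j \<epsilon>
    by (meson divide_nonneg_pos le_less_trans mult_nonneg_nonneg zero_le_numeral)
  have A: "4 * (real (card D) * (2 / real j + 3 * b\<^sup>2 * C' / real j)) \<le> \<epsilon> / 8"
  proof -
    have "4 * (real (card D) * (2 / real j + 3 * b\<^sup>2 * C' / real j)) = A / real j"
      by (simp add: A_def add_divide_distrib[symmetric])
    also have "\<dots> \<le> \<epsilon> / 8" using j j0 \<epsilon> by (simp add: field_simps)
    finally show ?thesis .
  qed
  obtain I and \<phi> :: "('a \<Rightarrow> nat) \<Rightarrow> 'a \<Rightarrow> real" where \<phi>: "weak_partition I \<phi>"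
    "\<And>k x x' d. \<lbrakk>k \<in> I; \<phi> k x \<noteq> 0; \<phi> k x' \<noteq> 0; d \<in> D\<rbrakk>
      \<Longrightarrow> \<bar>(x - x') \<bullet> d\<bar> \<le> 2 / real j + ((x \<bullet> d)\<^sup>2 + (x' \<bullet> d)\<^sup>2) / real j"
    using fine_weak_partition[OF D, of j] j0 by auto
  have "(\<lambda>n. 4 * (real (card D) * real j * (1 - block_overlap I \<phi> (\<mu>s n) \<mu>))) \<longlonglongrightarrow> 4 * (real (card D) *
    real j * (1 - 1))"
    by (intro tendsto_intros block_overlap_tendsto_1 \<phi> P2 lim)
  from order_tendstoD(2)[OF this, of "\<epsilon> / 8"]
  have "\<forall>\<^sub>F n in sequentially. 4 * (real (card D) * real j * (1 - block_overlap I \<phi> (\<mu>s n) \<mu>)) < \<epsilon> / 8"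
    using \<epsilon> by simp
  then show ?thesis
  proof eventually_elim
    case (elim n)
    show ?case
    proof
      assume "(\<integral>x. (norm x)\<^sup>2 \<partial>\<mu>s n) \<le> C"
      then have C: "(\<integral>x. (norm x)\<^sup>2 \<partial>\<mu>s n) + (\<integral>x. (norm x)\<^sup>2 \<partial>\<mu>) \<le> C'" by (simp add: C'_def)
      obtain \<gamma> where \<gamma>: "\<gamma> \<in> couplings (\<mu>s n) \<nu>"
        "(\<integral>z. (norm (fst z - snd z))\<^sup>2 \<partial>\<gamma>) < (W2 (\<mu>s n) \<nu>)\<^sup>2 + \<epsilon> / 4"
        using W2_near_optimal[OF P2(1)[of n] P2(3), of "\<epsilon> / 4"] \<epsilon> by auto
      interpret partitioned_pair I \<phi> "\<mu>s n" \<mu>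
        by (rule partitioned_pair.intro[OF \<phi>(1) P2D(1)[OF P2(1)] P2D(1)[OF P2(2)] P2D(2)[OF P2(1)]
          P2D(2)[OF P2(2)]])
      have "(W2 (\<mu>s n) \<mu>)\<^sup>2 + (W2 \<nu> \<mu>)\<^sup>2 \<le> (\<integral>z. (norm (fst z - snd z))\<^sup>2 \<partial>\<gamma>) + 4 * \<eta> * C' + 2 * e / \<eta>
         + 4 * (real (card D) * (2 / real j + 3 * b\<^sup>2 * C' / real j) + real (card D) * real j * (1 -
           block_overlap I \<phi> (\<mu>s n) \<mu>))"
        using b by (intro W2_split_le[OF P2(1) P2(2,3) \<gamma>(1) D _ j0 \<phi>(2) s(1) t(1) _ _ s(3,4) t(3,4) C \<eta>])
          (auto simp: D_def)
      then show "(W2 (\<mu>s n) \<mu>)\<^sup>2 + (W2 \<nu> \<mu>)\<^sup>2 \<le> (W2 (\<mu>s n) \<nu>)\<^sup>2 + \<epsilon>"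
        using A elim \<gamma>(2) unfolding \<eta>_eq e_eq distrib_left by linarith
    qed
  qed
qed

text \<open>The indices at which the distance to \<open>\<nu>\<close> is small have bounded second
  moments by \<open>second_moment_le\<close>, so the eventual estimate applies to exactly these
  indices.\<close>

lemma frequently_W2_split:
  fixes \<mu>s :: "nat \<Rightarrow> 'a::{real_inner, complete_space, second_countable_topology} measure"
  assumes P2: "\<And>n. \<mu>s n \<in> P2" "\<mu> \<in> P2" "\<nu> \<in> P2"
    and lim: "limitin P2w \<mu>s \<mu> sequentially" and \<epsilon>: "0 < \<epsilon>"
    and freq: "\<exists>\<^sub>F n in sequentially. (W2 (\<mu>s n) \<nu>)\<^sup>2 < c"
  shows "\<exists>\<^sub>F n in sequentially. (W2 (\<mu>s n) \<mu>)\<^sup>2 + (W2 \<nu> \<mu>)\<^sup>2 < c + \<epsilon>"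
proof -
  let ?C = "2 * (c + (\<integral>x. (norm x)\<^sup>2 \<partial>\<nu>))"
  have "\<exists>\<^sub>F n in sequentially. (W2 (\<mu>s n) \<nu>)\<^sup>2 < c \<and> ((\<integral>x. (norm x)\<^sup>2 \<partial>\<mu>s n) \<le> ?C \<longrightarrow>
    (W2 (\<mu>s n) \<mu>)\<^sup>2 + (W2 \<nu> \<mu>)\<^sup>2 \<le> (W2 (\<mu>s n) \<nu>)\<^sup>2 + \<epsilon>)"
    using freq eventually_W2_split[OF assms(1-5)] by (rule frequently_eventually_frequently)
  then show ?thesis
  proof (rule frequently_elim1)
    fix n
    assume n: "(W2 (\<mu>s n) \<nu>)\<^sup>2 < c \<and> ((\<integral>x. (norm x)\<^sup>2 \<partial>\<mu>s n) \<le> ?C \<longrightarrow>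
      (W2 (\<mu>s n) \<mu>)\<^sup>2 + (W2 \<nu> \<mu>)\<^sup>2 \<le> (W2 (\<mu>s n) \<nu>)\<^sup>2 + \<epsilon>)"
    then have "2 * ((W2 (\<mu>s n) \<nu>)\<^sup>2 + (\<integral>x. (norm x)\<^sup>2 \<partial>\<nu>)) \<le> ?C" by simp
    with second_moment_le[OF P2(1) P2(3)] have "(\<integral>x. (norm x)\<^sup>2 \<partial>\<mu>s n) \<le> ?C" by (rule order_trans)
    then show "(W2 (\<mu>s n) \<mu>)\<^sup>2 + (W2 \<nu> \<mu>)\<^sup>2 < c + \<epsilon>" using n by linarith
  qed
qed

lemma W2_square_le_second_moments:
  assumes "\<mu> \<in> P2" "\<nu> \<in> P2"
  shows "(W2 \<mu> \<nu>)\<^sup>2 \<le> 2 * ((\<integral>x. (norm x)\<^sup>2 \<partial>\<mu>) + (\<integral>x. (norm x)\<^sup>2 \<partial>\<nu>))"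
proof -
  note \<gamma> = couplingsD[OF pair_measure_coupling[OF assms]]
  note [measurable_cong] = \<gamma>(2)
  have m: "fst \<in> borel_measurable (\<mu> \<Otimes>\<^sub>M \<nu>)" "snd \<in> borel_measurable (\<mu> \<Otimes>\<^sub>M \<nu>)"
    unfolding measurable_cong_sets[OF \<gamma>(2) refl] by measurable
  note fst = integral_distr_P2[OF assms(1) m(1) \<gamma>(3)]
    and snd = integral_distr_P2[OF assms(2) m(2) \<gamma>(4)]
  have "(W2 \<mu> \<nu>)\<^sup>2 \<le> (\<integral>z. (norm (fst z - snd z))\<^sup>2 \<partial>(\<mu> \<Otimes>\<^sub>M \<nu>))"
    by (intro W2_square_le assms pair_measure_coupling)
  also have "\<dots> \<le> (\<integral>z. 2 * ((norm (fst z))\<^sup>2 + (norm (snd z))\<^sup>2) \<partial>(\<mu> \<Otimes>\<^sub>M \<nu>))"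
    using fst snd m norm_diff_square_le by (intro integral_mono integrable_norm_diff_square) auto
  finally show ?thesis using fst snd by simp
qed

lemma liminf_less_imp_frequently:
  fixes f :: "nat \<Rightarrow> ereal"
  assumes "liminf f < c"
  shows "\<exists>\<^sub>F n in sequentially. f n < c"
proof (rule ccontr)
  assume "\<not> ?thesis"
  then have "\<forall>\<^sub>F n in sequentially. c \<le> f n" by (simp add: frequently_def not_less)
  then have "c \<le> liminf f" by (rule Liminf_bounded)
  then show False using assms by simp
qed

lemma frequently_le_imp_liminf_le:
  fixes f :: "nat \<Rightarrow> ereal"
  assumes "\<exists>\<^sub>F n in sequentially. f n \<le> c"
  shows "liminf f \<le> c"
proof (rule ccontr)
  assume "\<not> ?thesis"
  then have "\<forall>\<^sub>F n in sequentially. c < f n" by (intro less_LiminfD) simp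
  then show False using assms by (simp add: frequently_def not_le)
qed

theorem theorem5p1:
  fixes \<mu>s :: "nat \<Rightarrow> 'a::{real_inner, complete_space, second_countable_topology} measure"
    and \<mu> :: "'a measure"
  assumes "\<And>n. \<mu>s n \<in> P2"
    and "\<mu> \<in> P2"
    and "limitin P2w \<mu>s \<mu> sequentially"
  shows "(\<forall>\<nu>\<in>P2. ereal ((W2 \<nu> \<mu>)\<^sup>2) + liminf (\<lambda>n. ereal ((W2 (\<mu>s n) \<mu>)\<^sup>2))
            \<le> liminf (\<lambda>n. ereal ((W2 (\<mu>s n) \<nu>)\<^sup>2)))
       \<and> (\<forall>\<nu>\<in>P2. \<nu> \<noteq> \<mu> \<longrightarrow>
            liminf (\<lambda>n. ereal (W2 (\<mu>s n) \<mu>)) < liminf (\<lambda>n. ereal (W2 (\<mu>s n) \<nu>)))"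
proof (intro conjI ballI impI)
  fix \<nu> :: "'a measure" assume \<nu>: "\<nu> \<in> P2"
  note frequently = frequently_W2_split[OF assms(1,2) \<nu> assms(3)]
  show "ereal ((W2 \<nu> \<mu>)\<^sup>2) + liminf (\<lambda>n. ereal ((W2 (\<mu>s n) \<mu>)\<^sup>2)) \<le> liminf (\<lambda>n. ereal ((W2 (\<mu>s n) \<nu>)\<^sup>2))"
  \<comment> \<open>Testing against real upper bounds \<open>c\<close> also covers an infinite
    right-hand side, which has none.\<close>
  proof (rule ereal_le_real)
    fix c assume c: "liminf (\<lambda>n. ereal ((W2 (\<mu>s n) \<nu>)\<^sup>2)) \<le> ereal c"
    show "ereal ((W2 \<nu> \<mu>)\<^sup>2) + liminf (\<lambda>n. ereal ((W2 (\<mu>s n) \<mu>)\<^sup>2)) \<le> ereal c"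
    proof (rule ereal_le_epsilon2)
      fix \<epsilon> :: real assume \<epsilon>: "0 < \<epsilon>"
      have "liminf (\<lambda>n. ereal ((W2 (\<mu>s n) \<nu>)\<^sup>2)) < ereal (c + \<epsilon> / 2)"
        using c \<epsilon> by (auto elim: le_less_trans)
      then have "\<exists>\<^sub>F n in sequentially. (W2 (\<mu>s n) \<mu>)\<^sup>2 + (W2 \<nu> \<mu>)\<^sup>2 < (c + \<epsilon> / 2) + \<epsilon> / 2"
        using \<epsilon> liminf_less_imp_frequently by (intro frequently) fastforce+
      then have "\<exists>\<^sub>F n in sequentially. ereal ((W2 (\<mu>s n) \<mu>)\<^sup>2) \<le> ereal (c + \<epsilon> - (W2 \<nu> \<mu>)\<^sup>2)"
        by (rule frequently_elim1) simp
      then have "liminf (\<lambda>n. ereal ((W2 (\<mu>s n) \<mu>)\<^sup>2)) \<le> ereal (c + \<epsilon> - (W2 \<nu> \<mu>)\<^sup>2)"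
        by (rule frequently_le_imp_liminf_le)
      then have "ereal ((W2 \<nu> \<mu>)\<^sup>2) + liminf (\<lambda>n. ereal ((W2 (\<mu>s n) \<mu>)\<^sup>2))
          \<le> ereal ((W2 \<nu> \<mu>)\<^sup>2) + ereal (c + \<epsilon> - (W2 \<nu> \<mu>)\<^sup>2)"
        by (rule add_left_mono)
      then show "ereal ((W2 \<nu> \<mu>)\<^sup>2) + liminf (\<lambda>n. ereal ((W2 (\<mu>s n) \<mu>)\<^sup>2)) \<le> ereal c + ereal \<epsilon>"
        by simp
    qed
  qed
  assume "\<nu> \<noteq> \<mu>"
  then have d: "0 < (W2 \<nu> \<mu>)\<^sup>2"
    using W2_eq_0_imp_eq[OF \<nu> assms(2)] by auto
  show "liminf (\<lambda>n. ereal (W2 (\<mu>s n) \<mu>)) < liminf (\<lambda>n. ereal (W2 (\<mu>s n) \<nu>))"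
  proof (cases "liminf (\<lambda>n. ereal (W2 (\<mu>s n) \<nu>))")
    case (real B)
    have "0 \<le> liminf (\<lambda>n. ereal (W2 (\<mu>s n) \<nu>))"
      by (intro Liminf_bounded always_eventually allI) (simp add: W2_nonneg)
    then have B: "0 \<le> B" using real by simp
    \<comment> \<open>With threshold \<open>B\<^sup>2 + \<delta>\<close> and error
      \<open>\<delta>\<close>, subtracting the squared distance \<open>4 * \<delta>\<close> leaves
      \<open>B\<^sup>2 - 2 * \<delta>\<close>: a gap that is the same for infinitely many
      \<open>n\<close> and so survives the lower limit.\<close>
    define \<delta> where "\<delta> = (W2 \<nu> \<mu>)\<^sup>2 / 4"
    have \<delta>: "0 < \<delta>" using d by (simp add: \<delta>_def)
    have "B < sqrt (B\<^sup>2 + \<delta>)" using B \<delta> by (intro real_less_rsqrt) simp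
    then have "liminf (\<lambda>n. ereal (W2 (\<mu>s n) \<nu>)) < ereal (sqrt (B\<^sup>2 + \<delta>))" using real by simp
    then have "\<exists>\<^sub>F n in sequentially. ereal (W2 (\<mu>s n) \<nu>) < ereal (sqrt (B\<^sup>2 + \<delta>))"
      by (rule liminf_less_imp_frequently)
    then have "\<exists>\<^sub>F n in sequentially. (W2 (\<mu>s n) \<nu>)\<^sup>2 < B\<^sup>2 + \<delta>"
    proof (rule frequently_elim1)
      fix n assume "ereal (W2 (\<mu>s n) \<nu>) < ereal (sqrt (B\<^sup>2 + \<delta>))"
      then have "(W2 (\<mu>s n) \<nu>)\<^sup>2 < (sqrt (B\<^sup>2 + \<delta>))\<^sup>2"
        by (intro power_strict_mono) (auto simp: W2_nonneg)
      then show "(W2 (\<mu>s n) \<nu>)\<^sup>2 < B\<^sup>2 + \<delta>" using \<delta> by simp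
    qed
    from frequently[OF \<delta> this]
    have *: "\<exists>\<^sub>F n in sequentially. (W2 (\<mu>s n) \<mu>)\<^sup>2 \<le> B\<^sup>2 - 2 * \<delta>"
      by (rule frequently_elim1) (simp add: \<delta>_def)
    from * have "\<exists>\<^sub>F n in sequentially. ereal (W2 (\<mu>s n) \<mu>) \<le> ereal (sqrt (B\<^sup>2 - 2 * \<delta>))"
      by (rule frequently_elim1) (simp add: real_le_rsqrt)
    then have "liminf (\<lambda>n. ereal (W2 (\<mu>s n) \<mu>)) \<le> ereal (sqrt (B\<^sup>2 - 2 * \<delta>))"
      by (rule frequently_le_imp_liminf_le)
    also have "sqrt (B\<^sup>2 - 2 * \<delta>) < sqrt (B\<^sup>2)" using \<delta> by (intro real_sqrt_less_mono) simp
    then have "ereal (sqrt (B\<^sup>2 - 2 * \<delta>)) < ereal B" using B by simp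
    finally show ?thesis using real by simp
  next
    case PInf
    \<comment> \<open>With an infinite right-hand side the first inequality gives no strictness. It
      remains to see that the left-hand side is finite, which follows from second moments that are
      bounded infinitely often.\<close>
    obtain C where "\<exists>\<^sub>F n in sequentially. (\<integral>x. (norm x)\<^sup>2 \<partial>\<mu>s n) \<le> C"
      using second_moment_frequently_bounded[OF assms(1,3)] .
    then have "\<exists>\<^sub>F n in sequentially. ereal (W2 (\<mu>s n) \<mu>) \<le> ereal (sqrt (2 * (C + (\<integral>x. (norm x)\<^sup>2 \<partial>\<mu>))))"
    proof (rule frequently_elim1)
      fix n assume C: "(\<integral>x. (norm x)\<^sup>2 \<partial>\<mu>s n) \<le> C"
      have "(W2 (\<mu>s n) \<mu>)\<^sup>2 \<le> 2 * ((\<integral>x. (norm x)\<^sup>2 \<partial>\<mu>s n) + (\<integral>x. (norm x)\<^sup>2 \<partial>\<mu>))"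
        by (rule W2_square_le_second_moments[OF assms(1,2)])
      also have "\<dots> \<le> 2 * (C + (\<integral>x. (norm x)\<^sup>2 \<partial>\<mu>))" using C by simp
      finally show "ereal (W2 (\<mu>s n) \<mu>) \<le> ereal (sqrt (2 * (C + (\<integral>x. (norm x)\<^sup>2 \<partial>\<mu>))))"
        by (simp add: real_le_rsqrt)
    qed
    then have "liminf (\<lambda>n. ereal (W2 (\<mu>s n) \<mu>)) \<le> ereal (sqrt (2 * (C + (\<integral>x. (norm x)\<^sup>2 \<partial>\<mu>))))"
      by (rule frequently_le_imp_liminf_le)
    then show ?thesis using PInf by (auto elim: le_less_trans)
  next
    case MInf
    have "0 \<le> liminf (\<lambda>n. ereal (W2 (\<mu>s n) \<nu>))"
      by (intro Liminf_bounded always_eventually allI) (simp add: W2_nonneg)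
    then show ?thesis using MInf by simp
  qed
qed

end
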